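(* Let $q,\alpha,\beta$ be complex numbers with $|q|<1$. If $f(a,b)$ is a two-variable analytic function at $(0,0)\in\mathbb{C}^2$, then there exists a unique sequence $\{c_{n,m}\}_{n,m\ge 0}$, independent of $a$ and $b$, such that $$f(a,b)=\sum_{n=0}^\infty\sum_{m=0}^\infty c_{n,m}\,\frac{(1-\alpha q^{2n})(1-\beta q^{2m})(\alpha q/a;q)_n(\beta q/b;q)_m\,a^n b^m}{(q,a;q)_n\,(q,b;q)_m}.$$
   Context: The $q$-shifted factorials are $(x;q)_0=1$ and $(x;q)_n=\prod_{k=0}^{n-1}(1-xq^k)$ for $n\ge 1$, and $(x_1,\dots,x_r;q)_n=(x_1;q)_n\cdots(x_r;q)_n$. The product $(\alpha q/a;q)_n a^n$ is understood as the polynomial $\prod_{k=1}^{n}(a-\alpha q^{k})$ in $a$, and likewise $(\beta q/b;q)_m b^m=\prod_{k=1}^m(b-\beta q^k)$.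
   Formalization: Existence is proved near (0,0) except when q=0 and α=1 or β=1; uniqueness (with existence) is proved on bidiscs |a|<R, |b|<S where the power series of f converges, assuming |αq|<R, |βq|<S and αq^n≠1, βq^n≠1 for all n≥0. *)

theory Defs
  imports "HOL-Analysis.Analysis"
begin

definition qpoch :: "complex \<Rightarrow> complex \<Rightarrow> nat \<Rightarrow> complex" where
  "qpoch x q n = (\<Prod>k<n. 1 - x * q ^ k)"

(* The product (\<alpha>q/a; q)_n a^n, read as a polynomial in a (so that it makes sense at a = 0). *)
definition shifted_poly :: "complex \<Rightarrow> complex \<Rightarrow> complex \<Rightarrow> nat \<Rightarrow> complex" where
  "shifted_poly q \<alpha> a n = (\<Prod>k=1..n. a - \<alpha> * q ^ k)"

definition expansion_term ::
    "complex \<Rightarrow> complex \<Rightarrow> complex \<Rightarrow> complex \<Rightarrow> complex \<Rightarrow> nat \<Rightarrow> nat \<Rightarrow> complex" where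
  "expansion_term q \<alpha> \<beta> a b n m =
     ((1 - \<alpha> * q ^ (2 * n)) * (1 - \<beta> * q ^ (2 * m)) * shifted_poly q \<alpha> a n * shifted_poly q \<beta> b m)
     / ((qpoch q q n * qpoch a q n) * (qpoch q q m * qpoch b q m))"

(* f is the sum of an (unconditionally convergent) power series in two variables
   on the bidisc |a| < R, |b| < S. *)
definition power_series_on_bidisc ::
    "(complex \<Rightarrow> complex \<Rightarrow> complex) \<Rightarrow> real \<Rightarrow> real \<Rightarrow> bool" where
  "power_series_on_bidisc f R S \<longleftrightarrow>
     (\<exists>p :: nat \<Rightarrow> nat \<Rightarrow> complex. \<forall>a b. norm a < R \<longrightarrow> norm b < S \<longrightarrow>
        ((\<lambda>(i, j). p i j * a ^ i * b ^ j) has_sum f a b) UNIV)"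

definition analytic_at_origin :: "(complex \<Rightarrow> complex \<Rightarrow> complex) \<Rightarrow> bool" where
  "analytic_at_origin f \<longleftrightarrow> (\<exists>R>0. \<exists>S>0. power_series_on_bidisc f R S)"

(* The expansion of f holds, as an iterated series, at every point of the bidisc at which all of
   its terms are defined. The excluded points a = q^(-k), b = q^(-k) have modulus at least 1, so
   nothing is excluded when R and S are at most 1. *)
definition expands_on_bidisc ::
    "complex \<Rightarrow> complex \<Rightarrow> complex \<Rightarrow> (complex \<Rightarrow> complex \<Rightarrow> complex)
     \<Rightarrow> (nat \<Rightarrow> nat \<Rightarrow> complex) \<Rightarrow> real \<Rightarrow> real \<Rightarrow> bool" where
  "expands_on_bidisc q \<alpha> \<beta> f c R S \<longleftrightarrow>
     (\<forall>a b. norm a < R \<longrightarrow> norm b < S \<longrightarrow> (\<forall>k. a * q ^ k \<noteq> 1) \<longrightarrow> (\<forall>k. b * q ^ k \<noteq> 1) \<longrightarrow>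
        (\<forall>n. summable (\<lambda>m. c n m * expansion_term q \<alpha> \<beta> a b n m)) \<and>
        (\<lambda>n. \<Sum>m. c n m * expansion_term q \<alpha> \<beta> a b n m) sums f a b)"

end

theory Submission
  imports Defs
begin

text \<open>
Write \<open>\<phi>\<^sub>n(a) = (\<Prod>k=1..n. a - \<alpha>q\<^sup>k) / (a;q)\<^sub>n\<close>. Up to constants depending only on \<open>n\<close> and \<open>m\<close>, the
terms of the expansion are the products of \<open>\<phi>\<^sub>n(a)\<close> with the analogous functions of \<open>b\<close>, so everything
reduces to one variable.

In one variable the expansion is Newton interpolation at the nodes \<open>\<alpha>q, \<alpha>q\<^sup>2, \<dots>\<close>, with the rational
functions \<open>\<phi>\<^sub>n\<close> in place of the Newton polynomials. For \<open>g\<^sub>0(a) = a\<^sup>i\<close>, poles \<open>1/Y\<^sub>n\<close> and nodes \<open>X\<^sub>n\<close>,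
division with remainder gives polynomials \<open>g\<^sub>n\<close> and constants \<open>A\<^sub>i\<^sub>n\<close> with
\<open>(1 - aY\<^sub>n) g\<^sub>n(a) = A\<^sub>i\<^sub>n + (a - X\<^sub>n) g\<^sub>n\<^sub>+\<^sub>1(a)\<close>. In the norm \<open>\<Sum>\<^sub>l |g\<^sub>l| \<rho>\<^sup>l\<close> one such step costs a factor
\<open>(1 + \<rho>|Y\<^sub>n|) / (\<rho> - |X\<^sub>n|)\<close> if \<open>\<rho>\<close> exceeds all \<open>|X\<^sub>n|\<close>. Since the \<open>X\<^sub>n\<close> and \<open>Y\<^sub>n\<close> are absolutely
summable, this is \<open>1/\<rho>\<close> times the factor of a convergent product, hence \<open>|A\<^sub>i\<^sub>n| \<le> K \<rho>\<^sup>i \<rho>\<^sup>-\<^sup>n\<close>, while \<open>\<phi>\<^sub>n(a)\<close>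
is \<open>O(t\<^sup>n)\<close> for every \<open>t > |a|\<close>. So
\<open>a\<^sup>i = \<Sum>\<^sub>n A\<^sub>i\<^sub>n \<phi>\<^sub>n(a)\<close> with geometric convergence (\<open>newton_monomial_expansion\<close>). Inserting this and its
analogue for \<open>b\<close> in the power series \<open>\<Sum> p\<^sub>i\<^sub>j a\<^sup>i b\<^sup>j\<close> of \<open>f\<close> and summing over \<open>i, j\<close> first yields the coefficients
\<open>\<Sum>\<^sub>i\<^sub>j p\<^sub>i\<^sub>j A\<^sub>i\<^sub>n B\<^sub>j\<^sub>m\<close> (\<open>bidisc_expansion\<close>).

The normalising factor \<open>1 - \<alpha>q\<^sup>2\<^sup>n\<close> may vanish for some \<open>n\<close>, and finitely many nodes may lie outside the domain of
\<open>f\<close>. For an expansion near the origin the first \<open>K\<close> basis functions can then be given up: in a disc that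
contains none of the first \<open>K\<close> nodes, \<open>\<phi>\<^sub>K\<close> has no zero, so the functions \<open>a\<^sup>i/\<phi>\<^sub>K(a)\<close> are expanded in terms of
\<open>\<phi>\<^sub>K\<^sub>+\<^sub>n/\<phi>\<^sub>K\<close>, which is a basis of the same kind (\<open>node_basis_monomial_expansion\<close>).

When all nodes lie in the disc and none is a pole, the coefficients are unique: if the nodes are distinct, the
\<open>N\<close>-th coefficient is isolated by evaluating at the node \<open>\<alpha>q\<^sup>N\<^sup>+\<^sup>1\<close>, where all later basis functions
vanish; if \<open>\<alpha>q = 0\<close>, then \<open>\<phi>\<^sub>n(a) = a\<^sup>n/(a;q)\<^sub>n\<close> and it is the leading coefficient as \<open>a \<rightarrow> 0\<close>
(\<open>node_basis_coeff_zero\<close>). This is applied first in \<open>a\<close> and then in \<open>b\<close>.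
\<close>

section \<open>Bounded products and exchange of summations\<close>

lemma bounded_partial_products:
  fixes z :: "nat \<Rightarrow> 'a :: {real_normed_field, banach}"
  assumes "summable (\<lambda>k. norm (z k))"
  shows "\<exists>C. \<forall>n. norm (\<Prod>k<n. 1 - z k) \<le> C"
proof -
  have "abs_convergent_prod (\<lambda>k. 1 - z k)"
    by (rule summable_imp_abs_convergent_prod) (use assms in simp)
  then have "convergent (\<lambda>n. \<Prod>k\<le>n. 1 - z k)"
    by (intro convergent_prod_imp_convergent abs_convergent_prod_imp_convergent_prod)
  then have "convergent (\<lambda>n. \<Prod>k<n. 1 - z k)"
    unfolding convergent_def by (simp only: LIMSEQ_lessThan_iff_atMost)
  then show ?thesis
    by (meson BseqE convergent_imp_Bseq)
qed

text \<open>
A convergent product without vanishing factors has a nonzero limit, so its partial products stay away from \<open>0\<close>.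
\<close>

lemma bounded_inverse_partial_products:
  fixes z :: "nat \<Rightarrow> 'a :: {real_normed_field, banach}"
  assumes "summable (\<lambda>k. norm (z k))" and "\<And>k. z k \<noteq> 1"
  shows "\<exists>C>0. \<forall>n. norm (inverse (\<Prod>k<n. 1 - z k)) \<le> C"
proof -
  have "abs_convergent_prod (\<lambda>k. 1 - z k)"
    by (rule summable_imp_abs_convergent_prod) (use assms in simp)
  then have "convergent_prod (\<lambda>k. 1 - z k)"
    by (rule abs_convergent_prod_imp_convergent_prod)
  then obtain L where "(\<lambda>n. \<Prod>k\<le>n. 1 - z k) \<longlonglongrightarrow> L" "L \<noteq> 0"
    using assms(2) by (subst (asm) convergent_prod_iff_nz_lim) auto
  then have "(\<lambda>n. inverse (\<Prod>k<n. 1 - z k)) \<longlonglongrightarrow> inverse L"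
    by (intro tendsto_inverse) (simp_all add: LIMSEQ_lessThan_iff_atMost)
  then show ?thesis
    by (auto dest!: convergentI convergent_imp_Bseq simp: Bseq_def simp del: norm_inverse)
qed

lemma summable_on_product:
  fixes u :: "'a \<Rightarrow> real" and v :: "'b \<Rightarrow> real"
  assumes u: "u summable_on UNIV" and v: "v summable_on UNIV"
    and nonneg: "\<And>x. u x \<ge> 0" "\<And>y. v y \<ge> 0"
  shows "(\<lambda>(x, y). u x * v y) summable_on UNIV"
proof -
  have "(\<lambda>(x, y). u x * v y) summable_on Sigma UNIV (\<lambda>_. UNIV)"
  proof (rule summable_on_SigmaI)
    show "((\<lambda>y. (\<lambda>(x, y). u x * v y) (x, y)) has_sum u x * infsum v UNIV) UNIV" for x
      using has_sum_cmult_right[OF has_sum_infsum[OF v]] by simp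
    show "(\<lambda>x. u x * infsum v UNIV) summable_on UNIV"
      by (rule summable_on_cmult_left[OF u])
  qed (use nonneg in auto)
  then show ?thesis
    by simp
qed

lemma summable_on_complex_comparison:
  fixes f :: "'a \<Rightarrow> complex"
  assumes "g summable_on UNIV" "\<And>x. norm (f x) \<le> g x"
  shows "f summable_on UNIV"
  by (rule abs_summable_summable, rule Infinite_Sum.abs_summable_on_comparison_test'[OF assms(1)])
     (rule assms(2))

text \<open>
A product bound \<open>u x * v y\<close> makes the double family absolutely summable, which is all that is required of Fubini's
theorem. Every interchange below has this shape, with \<open>y\<close> running over basis indices and \<open>x\<close> over powers.
\<close>

lemma has_sum_exchange:
  fixes H :: "'a \<Rightarrow> 'b \<Rightarrow> complex" and u :: "'a \<Rightarrow> real" and v :: "'b \<Rightarrow> real"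
  assumes u: "u summable_on UNIV" and v: "v summable_on UNIV"
    and nonneg: "\<And>x. u x \<ge> 0" "\<And>y. v y \<ge> 0"
    and bound: "\<And>x y. norm (H x y) \<le> u x * v y"
    and rows: "\<And>x. (H x has_sum h x) UNIV"
    and total: "(h has_sum s) UNIV"
  shows "((\<lambda>y. \<Sum>\<^sub>\<infinity>x. H x y) has_sum s) UNIV"
proof -
  have "(\<lambda>(x, y). u x * v y) summable_on UNIV \<times> UNIV"
    using summable_on_product[OF u v nonneg] by simp
  then have "(\<lambda>p. norm (case p of (x, y) \<Rightarrow> H x y)) summable_on UNIV \<times> UNIV"
    by (rule Infinite_Sum.abs_summable_on_comparison_test') (use bound in auto)
  then have summable: "(\<lambda>(x, y). H x y) summable_on UNIV \<times> UNIV"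
    by (rule abs_summable_summable)
  have "((\<lambda>(x, y). H x y) has_sum s) (Sigma UNIV (\<lambda>_. UNIV))"
    using rows total summable by (intro has_sum_SigmaI[where g = h]) auto
  then have swapped: "((\<lambda>(y, x). H x y) has_sum s) (Sigma UNIV (\<lambda>_. UNIV))"
    by (subst (asm) has_sum_swap) simp
  have cols: "(\<lambda>x. H x y) summable_on UNIV" for y
    by (rule summable_on_complex_comparison[OF summable_on_cmult_left[OF u, of "v y"] bound])
  show ?thesis
    by (rule has_sum_SigmaD[OF swapped]) (use cols in simp)
qed

lemma has_sum_pairs_imp_iterated:
  fixes g :: "nat \<Rightarrow> nat \<Rightarrow> complex"
  assumes "((\<lambda>(n, m). g n m) has_sum s) UNIV"
  shows "summable (g n)" and "(\<lambda>n. \<Sum>m. g n m) sums s"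
proof -
  have *: "((\<lambda>(n, m). g n m) has_sum s) (Sigma UNIV (\<lambda>_. UNIV))"
    using assms by simp
  have rows: "g n summable_on UNIV" for n
    using summable_on_SigmaD1[OF has_sum_imp_summable[OF *], of n] by simp
  then show "summable (g n)"
    by (rule summable_on_imp_summable)
  have "(g n has_sum (\<Sum>m. g n m)) UNIV" for n
    using has_sum_infsum[OF rows[of n]] has_sum_imp_sums sums_unique by metis
  then have "((\<lambda>n. \<Sum>m. g n m) has_sum s) UNIV"
    by (intro has_sum_SigmaD[OF *]) auto
  then show "(\<lambda>n. \<Sum>m. g n m) sums s"
    by (rule has_sum_imp_sums)
qed

lemma summable_on_geometric:
  fixes \<theta> :: real
  assumes "0 \<le> \<theta>" "\<theta> < 1"
  shows "(\<lambda>n. \<theta> ^ n) summable_on UNIV"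
  using assms by (subst summable_on_UNIV_nonneg_real_iff) (auto intro: summable_geometric)

lemma has_sum_if_sums_geometric:
  fixes f :: "nat \<Rightarrow> complex"
  assumes "f sums s" "\<And>n. norm (f n) \<le> M * \<theta> ^ n" "0 \<le> \<theta>" "\<theta> < 1"
  shows "(f has_sum s) UNIV"
proof (rule norm_summable_imp_has_sum[OF _ assms(1)])
  have "summable (\<lambda>n. M * \<theta> ^ n)"
    using assms(3,4) by (intro summable_mult summable_geometric) auto
  then show "summable (\<lambda>n. norm (f n))"
    by (rule summable_comparison_test') (use assms(2) in auto)
qed

section \<open>A weighted norm on polynomials\<close>

text \<open>
This is \<open>\<Sum>\<^sub>i |p\<^sub>i| \<rho>\<^sup>i\<close>. In this norm, splitting off the value at \<open>x\<close> and dividing by \<open>z - x\<close> costs at most the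
factor \<open>1 / (\<rho> - |x|)\<close>. Estimating the subtraction in the supremum norm would cost a further factor \<open>2\<close> at each
interpolation step, which would ruin the growth rate of the coefficients.
\<close>

definition wnorm :: "real \<Rightarrow> complex poly \<Rightarrow> real" where
  "wnorm \<rho> p = poly (map_poly norm p) \<rho>"

lemma wnorm_0 [simp]: "wnorm \<rho> 0 = 0"
  by (simp add: wnorm_def)

lemma wnorm_pCons [simp]: "wnorm \<rho> (pCons c p) = norm c + \<rho> * wnorm \<rho> p"
  by (simp add: wnorm_def map_poly_pCons)

lemma wnorm_nonneg: "\<rho> \<ge> 0 \<Longrightarrow> wnorm \<rho> p \<ge> 0"
  by (induction p) auto

lemma wnorm_add: "\<rho> \<ge> 0 \<Longrightarrow> wnorm \<rho> (p + r) \<le> wnorm \<rho> p + wnorm \<rho> r"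
proof (induction p r rule: poly_induct2)
  case (pCons a p b r)
  have "\<rho> * wnorm \<rho> (p + r) \<le> \<rho> * (wnorm \<rho> p + wnorm \<rho> r)"
    using pCons by (intro mult_left_mono) auto
  then show ?case
    using norm_triangle_ineq[of a b] by (simp add: algebra_simps)
qed simp

lemma wnorm_smult: "wnorm \<rho> (smult c p) = norm c * wnorm \<rho> p"
  by (induction p) (simp_all add: algebra_simps norm_mult)

lemma wnorm_monom: "wnorm \<rho> (monom 1 i) = \<rho> ^ i"
  by (induction i) (simp_all add: monom_Suc monom_0)

lemma norm_poly_le_wnorm: "norm z \<le> \<rho> \<Longrightarrow> norm (poly p z) \<le> wnorm \<rho> p"
proof (induction p)
  case (pCons c p)
  then have "norm (z * poly p z) \<le> \<rho> * wnorm \<rho> p"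
    unfolding norm_mult using norm_ge_zero[of z] by (intro mult_mono) (linarith | simp)+
  then show ?case
    using norm_triangle_ineq[of c "z * poly p z"] by simp
qed simp

lemma wnorm_linear_factor:
  assumes "\<rho> \<ge> 0"
  shows "wnorm \<rho> ([:1, -y:] * p) \<le> (1 + \<rho> * norm y) * wnorm \<rho> p"
proof -
  have "wnorm \<rho> ([:1, -y:] * p) = wnorm \<rho> (p + pCons 0 (smult (-y) p))"
    by (simp add: mult_pCons_left)
  also have "\<dots> \<le> wnorm \<rho> p + wnorm \<rho> (pCons 0 (smult (-y) p))"
    by (rule wnorm_add[OF assms])
  also have "\<dots> = (1 + \<rho> * norm y) * wnorm \<rho> p"
    by (simp add: wnorm_smult norm_mult algebra_simps del: smult_minus_left)
  finally show ?thesis .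
qed

text \<open>
Subtracting the value \<open>|p(x)|\<close> on the right is what makes the induction on the coefficients close: the quotient of
\<open>c + z p(z)\<close> has constant term \<open>p(x)\<close>, whose contribution is absorbed by this gain.
\<close>

lemma wnorm_synthetic_div:
  assumes "norm x \<le> \<rho>"
  shows "(\<rho> - norm x) * wnorm \<rho> (synthetic_div p x) \<le> wnorm \<rho> p - norm (poly p x)"
proof (induction p)
  case (pCons c p)
  have "\<rho> \<ge> 0"
    using assms norm_ge_zero[of x] by linarith
  then have "\<rho> * ((\<rho> - norm x) * wnorm \<rho> (synthetic_div p x)) \<le> \<rho> * (wnorm \<rho> p - norm (poly p x))"
    using pCons by (intro mult_left_mono) auto
  moreover have "norm (c + x * poly p x) \<le> norm c + norm x * norm (poly p x)"
    by (metis norm_mult norm_triangle_ineq)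
  ultimately show ?case
    by (simp add: algebra_simps)
qed simp

section \<open>Expansions of all monomials\<close>

text \<open>
The numbers \<open>A i n\<close> are the coefficients of the monomial \<open>a\<^sup>i\<close> with respect to the functions \<open>E n\<close>, on the part
of the disc \<open>|a| < R\<close> that lies in \<open>D\<close> (the complement of the poles). The coefficients do not depend on \<open>\<rho>\<close>, only
the constant does; radii \<open>\<rho>\<close> arbitrarily close to \<open>R\<close> must be available so that any point of the disc can be handled.
\<close>

definition monomial_expansion ::
    "(nat \<Rightarrow> nat \<Rightarrow> complex) \<Rightarrow> (nat \<Rightarrow> complex \<Rightarrow> complex) \<Rightarrow> complex set \<Rightarrow> real \<Rightarrow> bool" where
  "monomial_expansion A E D R \<longleftrightarrow>
     (\<forall>s. 0 \<le> s \<longrightarrow> s < R \<longrightarrow>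
        (\<exists>\<rho>>s. \<rho> < R \<and> (\<exists>K. \<forall>i n. norm (A i n) * \<rho> ^ n \<le> K * \<rho> ^ i))) \<and>
     (\<forall>a\<in>D. norm a < R \<longrightarrow>
        (\<forall>i. (\<lambda>n. A i n * E n a) sums a ^ i) \<and>
        (\<forall>t>norm a. \<exists>C. \<forall>n. norm (E n a) \<le> C * t ^ n))"

lemma monomial_expansion_cong:
  assumes "monomial_expansion A E D R" "D' \<subseteq> D" "\<And>n a. a \<in> D' \<Longrightarrow> E n a = E' n a"
  shows "monomial_expansion A E' D' R"
proof -
  have "(\<lambda>n. E n a) = (\<lambda>n. E' n a)" if "a \<in> D'" for a
    using assms(3)[OF that] by auto
  then have "(\<forall>a\<in>D. norm a < R \<longrightarrow> P a (\<lambda>n. E n a)) \<longrightarrow>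
      (\<forall>a\<in>D'. norm a < R \<longrightarrow> P a (\<lambda>n. E' n a))" for P
    using assms(2) by (metis subsetD)
  from this[of "\<lambda>a e. (\<forall>i. (\<lambda>n. A i n * e n) sums a ^ i) \<and> (\<forall>t>norm a. \<exists>C. \<forall>n. norm (e n) \<le> C * t ^ n)"]
  show ?thesis
    using assms(1) unfolding monomial_expansion_def by blast
qed

text \<open>
At a fixed point \<open>a\<close> the growth of the coefficients and of the functions combine to geometric decay in \<open>n\<close>,
uniformly up to \<open>\<rho>\<^sup>i\<close>: choose \<open>|a| < t < \<rho> < R\<close> and \<open>\<theta> = t/\<rho>\<close>.
\<close>

lemma monomial_expansion_bound:
  assumes "monomial_expansion A E D R" "a \<in> D" "norm a < R"
  obtains \<rho> \<theta> M where "0 < \<rho>" "\<rho> < R" "0 \<le> \<theta>" "\<theta> < 1" "0 \<le> M"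
    "\<And>i n. norm (A i n * E n a) \<le> M * \<rho> ^ i * \<theta> ^ n"
proof -
  obtain \<rho> K where \<rho>: "norm a < \<rho>" "\<rho> < R" and K: "\<And>i n. norm (A i n) * \<rho> ^ n \<le> K * \<rho> ^ i"
    using assms(1,3) norm_ge_zero[of a] unfolding monomial_expansion_def by blast
  obtain t where t: "norm a < t" "t < \<rho>"
    using \<rho>(1) dense by blast
  have pos: "0 < \<rho>" "0 < t"
    using \<rho> t norm_ge_zero[of a] by linarith+
  obtain C where C: "\<And>n. norm (E n a) \<le> C * t ^ n"
    using assms t(1) unfolding monomial_expansion_def by blast
  have "0 \<le> K" "0 \<le> C"
    using order_trans[OF norm_ge_zero] K[of 0 0] C[of 0] by force+
  have "norm (A i n * E n a) \<le> (K * C) * \<rho> ^ i * (t / \<rho>) ^ n" for i n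
  proof -
    have "norm (A i n) \<le> K * \<rho> ^ i / \<rho> ^ n"
      using K[of i n] pos by (simp add: field_simps)
    then have "norm (A i n * E n a) \<le> (K * \<rho> ^ i / \<rho> ^ n) * (C * t ^ n)"
      unfolding norm_mult using C[of n] \<open>0 \<le> K\<close> pos by (intro mult_mono) auto
    then show ?thesis
      by (simp add: power_divide mult_ac)
  qed
  with pos \<rho> t \<open>0 \<le> K\<close> \<open>0 \<le> C\<close> show thesis
    by (intro that[of \<rho> "t / \<rho>" "K * C"]) auto
qed

text \<open>
Expansions survive a new pole because \<open>a\<^sup>i = (a\<^sup>i - y a\<^sup>i\<^sup>+\<^sup>1) / (1 - ay)\<close>.
\<close>

lemma monomial_expansion_divide:
  assumes "monomial_expansion A E D R"
  shows "monomial_expansion (\<lambda>i n. A i n - y * A (Suc i) n) (\<lambda>n a. E n a / (1 - a * y))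
           {a \<in> D. a * y \<noteq> 1} R"
  unfolding monomial_expansion_def
proof (intro conjI allI ballI impI)
  fix s assume s: "0 \<le> s" "s < R"
  then obtain \<rho> K where \<rho>: "s < \<rho>" "\<rho> < R" and K: "\<And>i n. norm (A i n) * \<rho> ^ n \<le> K * \<rho> ^ i"
    using assms unfolding monomial_expansion_def by blast
  have "norm (A i n - y * A (Suc i) n) * \<rho> ^ n \<le> (K + norm y * K * \<rho>) * \<rho> ^ i" for i n
  proof -
    have "norm (A i n - y * A (Suc i) n) * \<rho> ^ n \<le> (norm (A i n) + norm y * norm (A (Suc i) n)) * \<rho> ^ n"
      using s \<rho> norm_triangle_ineq4[of "A i n" "y * A (Suc i) n"]
      by (intro mult_right_mono) (auto simp: norm_mult)
    also have "\<dots> = norm (A i n) * \<rho> ^ n + norm y * (norm (A (Suc i) n) * \<rho> ^ n)"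
      by (simp add: algebra_simps)
    also have "\<dots> \<le> K * \<rho> ^ i + norm y * (K * \<rho> ^ Suc i)"
      by (intro add_mono K mult_left_mono) auto
    finally show ?thesis
      by (simp add: algebra_simps)
  qed
  with \<rho> show "\<exists>\<rho>>s. \<rho> < R \<and> (\<exists>K. \<forall>i n. norm (A i n - y * A (Suc i) n) * \<rho> ^ n \<le> K * \<rho> ^ i)"
    by blast
next
  fix a i assume "a \<in> {a \<in> D. a * y \<noteq> 1}" "norm a < R"
  then have a: "a \<in> D" "1 - a * y \<noteq> 0" "norm a < R"
    by auto
  then have "(\<lambda>n. A i n * E n a) sums a ^ i" "(\<lambda>n. A (Suc i) n * E n a) sums a ^ Suc i"
    using assms unfolding monomial_expansion_def by blast+
  then have "(\<lambda>n. (A i n * E n a - y * (A (Suc i) n * E n a)) / (1 - a * y))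
      sums ((a ^ i - y * a ^ Suc i) / (1 - a * y))"
    by (intro sums_divide sums_diff sums_mult)
  moreover have "a ^ i - y * a ^ Suc i = a ^ i * (1 - a * y)"
    by (simp add: algebra_simps)
  moreover have "(A i n * E n a - y * (A (Suc i) n * E n a)) / (1 - a * y) =
      (A i n - y * A (Suc i) n) * (E n a / (1 - a * y))" for n
    unfolding left_diff_distrib times_divide_eq_right mult.assoc ..
  ultimately show "(\<lambda>n. (A i n - y * A (Suc i) n) * (E n a / (1 - a * y))) sums a ^ i"
    using a(2) by simp
next
  fix a t assume "a \<in> {a \<in> D. a * y \<noteq> 1}" "norm a < R" "norm a < t"
  then obtain C where C: "\<And>n. norm (E n a) \<le> C * t ^ n"
    using assms unfolding monomial_expansion_def by blast
  have "norm (E n a / (1 - a * y)) \<le> (C / norm (1 - a * y)) * t ^ n" for n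
    using divide_right_mono[OF C[of n], of "norm (1 - a * y)"] by (simp add: norm_divide)
  then show "\<exists>C. \<forall>n. norm (E n a / (1 - a * y)) \<le> C * t ^ n"
    by blast
qed

text \<open>
For \<open>|a| < |x|\<close> the geometric series gives \<open>a\<^sup>i = (a - x) (- \<Sum>\<^sub>l a\<^sup>i\<^sup>+\<^sup>l / x\<^sup>l\<^sup>+\<^sup>1)\<close>, and the powers on the right are
expanded in terms of the \<open>E n\<close>.
\<close>

lemma monomial_expansion_times_node:
  assumes exp: "monomial_expansion A E D R" and x: "0 < R" "R \<le> norm x"
  shows "monomial_expansion (\<lambda>i n. - (\<Sum>\<^sub>\<infinity>l. A (i + l) n / x ^ Suc l)) (\<lambda>n a. (a - x) * E n a) D R"
  unfolding monomial_expansion_def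
proof (intro conjI allI ballI impI)
  fix s assume s: "0 \<le> s" "s < R"
  then obtain \<rho> K where \<rho>: "s < \<rho>" "\<rho> < R" and K: "\<And>i n. norm (A i n) * \<rho> ^ n \<le> K * \<rho> ^ i"
    using exp unfolding monomial_expansion_def by blast
  define q where "q = \<rho> / norm x"
  have q: "0 \<le> q" "q < 1"
    using s \<rho> x by (auto simp: q_def divide_less_eq)
  define L where "L = (\<Sum>\<^sub>\<infinity>l. q ^ l)"
  have "norm (- (\<Sum>\<^sub>\<infinity>l. A (i + l) n / x ^ Suc l)) * \<rho> ^ n \<le> (K / norm x * L) * \<rho> ^ i" for i n
  proof -
    define g where "g l = (K * \<rho> ^ i / \<rho> ^ n / norm x) * q ^ l" for l
    have g: "g summable_on UNIV"
      unfolding g_def using q by (intro summable_on_cmult_right summable_on_geometric)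
    have le: "norm (A (i + l) n / x ^ Suc l) \<le> g l" for l
    proof -
      have "norm (A (i + l) n) \<le> K * \<rho> ^ (i + l) / \<rho> ^ n"
        using K[of "i + l" n] s \<rho> by (simp add: field_simps)
      then have "norm (A (i + l) n) / norm (x ^ Suc l) \<le> (K * \<rho> ^ (i + l) / \<rho> ^ n) / norm (x ^ Suc l)"
        by (rule divide_right_mono) simp
      then show ?thesis
        by (simp add: g_def q_def norm_divide norm_mult norm_power power_add power_divide mult_ac)
    qed
    have "norm (\<Sum>\<^sub>\<infinity>l. A (i + l) n / x ^ Suc l) \<le> (\<Sum>\<^sub>\<infinity>l. g l)"
      using g le by (intro norm_infsum_le[OF has_sum_infsum has_sum_infsum]
          summable_on_complex_comparison[OF g]) auto
    also have "\<dots> = (K / norm x * L) * \<rho> ^ i / \<rho> ^ n"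
      unfolding g_def L_def infsum_cmult_right' by (simp add: mult_ac)
    finally show ?thesis
      unfolding norm_minus_cancel
      by (subst pos_le_divide_eq[symmetric]) (use s \<rho> in auto)
  qed
  with \<rho> show "\<exists>\<rho>>s. \<rho> < R \<and>
      (\<exists>K. \<forall>i n. norm (- (\<Sum>\<^sub>\<infinity>l. A (i + l) n / x ^ Suc l)) * \<rho> ^ n \<le> K * \<rho> ^ i)"
    by blast
next
  fix a i assume a: "a \<in> D" "norm a < R"
  obtain \<rho> \<theta> M where \<rho>: "0 < \<rho>" "\<rho> < R" and \<theta>: "0 \<le> \<theta>" "\<theta> < 1" and M: "0 \<le> M"
    and bound: "\<And>i n. norm (A i n * E n a) \<le> M * \<rho> ^ i * \<theta> ^ n"
    using monomial_expansion_bound[OF exp a] by blast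
  have x0: "x \<noteq> 0"
    using x by auto
  have sums: "(\<lambda>n. A j n * E n a) sums a ^ j" for j
    using exp a unfolding monomial_expansion_def by blast
  define H where "H l n = A (i + l) n * E n a * ((x - a) / x ^ Suc l)" for l n
  \<comment> \<open>The sum over \<open>n\<close> for fixed \<open>l\<close> expands \<open>a\<^sup>i\<^sup>+\<^sup>l\<close>; summing over \<open>l\<close> first gives the new coefficients.\<close>
  have "((\<lambda>n. \<Sum>\<^sub>\<infinity>l. H l n) has_sum a ^ i) UNIV"
  proof (rule has_sum_exchange)
    show "(\<lambda>l. (\<rho> / norm x) ^ l) summable_on UNIV"
      using \<rho> x by (intro summable_on_geometric) (auto simp: divide_less_eq)
    show "(\<lambda>n. (M * \<rho> ^ i * norm (x - a) / norm x) * \<theta> ^ n) summable_on UNIV"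
      using \<theta> by (intro summable_on_cmult_right summable_on_geometric)
    show "0 \<le> (\<rho> / norm x) ^ l" for l
      using \<rho> by simp
    show "0 \<le> (M * \<rho> ^ i * norm (x - a) / norm x) * \<theta> ^ n" for n
      using \<rho> \<theta> M by simp
    show "norm (H l n) \<le> (\<rho> / norm x) ^ l * ((M * \<rho> ^ i * norm (x - a) / norm x) * \<theta> ^ n)" for l n
    proof -
      have "norm (H l n) \<le> (M * \<rho> ^ (i + l) * \<theta> ^ n) * norm ((x - a) / x ^ Suc l)"
        unfolding H_def norm_mult[of "_ * _"] by (intro mult_right_mono bound) auto
      then show ?thesis
        by (simp add: norm_divide norm_mult norm_power power_add power_divide mult_ac)
    qed
    show "(H l has_sum a ^ (i + l) * ((x - a) / x ^ Suc l)) UNIV" for l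
      unfolding H_def
      by (intro has_sum_cmult_left has_sum_if_sums_geometric[OF sums bound \<theta>])
    show "((\<lambda>l. a ^ (i + l) * ((x - a) / x ^ Suc l)) has_sum a ^ i) UNIV"
    proof -
      have less: "norm (a / x) < 1"
        using a x by (auto simp: norm_divide divide_less_eq)
      have "(\<lambda>l. a ^ i * ((x - a) / x) * (a / x) ^ l) sums (a ^ i * ((x - a) / x) * (1 / (1 - a / x)))"
        by (intro sums_mult geometric_sums less)
      moreover have "x - a \<noteq> 0"
        using a x by auto
      then have "a ^ i * ((x - a) / x) * (1 / (1 - a / x)) = a ^ i"
        using x0 by (simp add: field_simps)
      ultimately have "((\<lambda>l. a ^ i * ((x - a) / x) * (a / x) ^ l) has_sum a ^ i) UNIV"
        using less by (intro has_sum_if_sums_geometric[where \<theta> = "norm (a / x)"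
              and M = "norm (a ^ i * ((x - a) / x))"])
          (auto simp: norm_mult norm_power norm_divide)
      then show ?thesis
        by (simp add: power_add power_divide mult_ac)
    qed
  qed
  moreover have "(\<Sum>\<^sub>\<infinity>l. H l n) = - (\<Sum>\<^sub>\<infinity>l. A (i + l) n / x ^ Suc l) * ((a - x) * E n a)" for n
  proof -
    have "(\<Sum>\<^sub>\<infinity>l. H l n) = (\<Sum>\<^sub>\<infinity>l. A (i + l) n / x ^ Suc l * ((x - a) * E n a))"
      unfolding H_def by (intro infsum_cong) (simp add: mult_ac)
    also have "\<dots> = (\<Sum>\<^sub>\<infinity>l. A (i + l) n / x ^ Suc l) * ((x - a) * E n a)"
      by (rule infsum_cmult_left')
    finally show ?thesis
      by (simp add: algebra_simps)
  qed
  ultimately show "(\<lambda>n. - (\<Sum>\<^sub>\<infinity>l. A (i + l) n / x ^ Suc l) * ((a - x) * E n a)) sums a ^ i"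
    using has_sum_imp_sums by simp
next
  fix a t assume a: "a \<in> D" "norm a < R" "norm a < t"
  then obtain C where C: "\<And>n. norm (E n a) \<le> C * t ^ n"
    using exp unfolding monomial_expansion_def by blast
  have "norm ((a - x) * E n a) \<le> (norm (a - x) * C) * t ^ n" for n
    using mult_left_mono[OF C[of n], of "norm (a - x)"] by (simp add: norm_mult mult_ac)
  then show "\<exists>C. \<forall>n. norm ((a - x) * E n a) \<le> C * t ^ n"
    by blast
qed

lemma monomial_expansion_times_rational_factor:
  fixes K :: nat
  assumes "monomial_expansion A E D R" "0 < R" "\<And>k. k < K \<Longrightarrow> R \<le> norm (x k)"
  shows "\<exists>A'. monomial_expansion A'
    (\<lambda>n a. (\<Prod>k<K. a - x k) / (\<Prod>k<K. 1 - a * y k) * E n a) {a \<in> D. \<forall>k<K. a * y k \<noteq> 1} R"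
  using assms(3)
proof (induction K)
  case 0
  then show ?case
    using assms(1) by auto
next
  case (Suc K)
  let ?E = "\<lambda>n a. (\<Prod>k<K. a - x k) / (\<Prod>k<K. 1 - a * y k) * E n a"
  obtain A' where "monomial_expansion A' ?E {a \<in> D. \<forall>k<K. a * y k \<noteq> 1} R"
    using Suc by auto
  then have "monomial_expansion (\<lambda>i n. - (\<Sum>\<^sub>\<infinity>l. A' (i + l) n / x K ^ Suc l))
      (\<lambda>n a. (a - x K) * ?E n a) {a \<in> D. \<forall>k<K. a * y k \<noteq> 1} R" (is "monomial_expansion ?B _ _ _")
    using Suc.prems assms(2) by (intro monomial_expansion_times_node) auto
  then have "monomial_expansion (\<lambda>i n. ?B i n - y K * ?B (Suc i) n)
      (\<lambda>n a. (a - x K) * ?E n a / (1 - a * y K))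
      {a \<in> {a \<in> D. \<forall>k<K. a * y k \<noteq> 1}. a * y K \<noteq> 1} R"
    by (rule monomial_expansion_divide)
  then have "monomial_expansion (\<lambda>i n. ?B i n - y K * ?B (Suc i) n)
      (\<lambda>n a. (\<Prod>k<Suc K. a - x k) / (\<Prod>k<Suc K. 1 - a * y k) * E n a)
      {a \<in> D. \<forall>k<Suc K. a * y k \<noteq> 1} R"
    by (rule monomial_expansion_cong) (auto simp: less_Suc_eq mult_ac)
  then show ?case
    by blast
qed

text \<open>
Expanding each monomial of a double power series and collecting the terms with the same basis functions. The
majorant combines the absolute convergence of the power series at the point \<open>(\<rho>, \<sigma>)\<close> with geometric decay in the
basis indices.
\<close>

lemma bidisc_expansion:
  assumes A: "monomial_expansion A E D R" and B: "monomial_expansion B F D' S"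
    and p: "\<And>a b. norm a < R \<Longrightarrow> norm b < S \<Longrightarrow>
              ((\<lambda>(i, j). p i j * a ^ i * b ^ j) has_sum f a b) UNIV"
    and a: "a \<in> D" "norm a < R" and b: "b \<in> D'" "norm b < S"
  shows "((\<lambda>(n, m). (\<Sum>\<^sub>\<infinity>(i, j). p i j * A i n * B j m) * (E n a * F m b)) has_sum f a b) UNIV"
proof -
  obtain \<rho> \<theta> M where \<rho>: "0 < \<rho>" "\<rho> < R" and \<theta>: "0 \<le> \<theta>" "\<theta> < 1" and M: "0 \<le> M"
    and bA: "\<And>i n. norm (A i n * E n a) \<le> M * \<rho> ^ i * \<theta> ^ n"
    using monomial_expansion_bound[OF A a] by blast
  obtain \<sigma> \<eta> N where \<sigma>: "0 < \<sigma>" "\<sigma> < S" and \<eta>: "0 \<le> \<eta>" "\<eta> < 1" and N: "0 \<le> N"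
    and bB: "\<And>j m. norm (B j m * F m b) \<le> N * \<sigma> ^ j * \<eta> ^ m"
    using monomial_expansion_bound[OF B b] by blast
  have sumA: "((\<lambda>n. A i n * E n a) has_sum a ^ i) UNIV" for i
  proof (rule has_sum_if_sums_geometric[OF _ bA \<theta>])
    show "(\<lambda>n. A i n * E n a) sums a ^ i"
      using A a unfolding monomial_expansion_def by blast
  qed
  have sumB: "((\<lambda>m. B j m * F m b) has_sum b ^ j) UNIV" for j
  proof (rule has_sum_if_sums_geometric[OF _ bB \<eta>])
    show "(\<lambda>m. B j m * F m b) sums b ^ j"
      using B b unfolding monomial_expansion_def by blast
  qed
  define u where "u = (\<lambda>(i, j). norm (p i j) * \<rho> ^ i * \<sigma> ^ j)"
  define v where "v = (\<lambda>(n, m). (M * \<theta> ^ n) * (N * \<eta> ^ m))"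
  define H where "H = (\<lambda>(i, j) (n, m). p i j * ((A i n * E n a) * (B j m * F m b)))"
  define h where "h = (\<lambda>(i, j). p i j * a ^ i * b ^ j)"
  have v: "v summable_on UNIV"
    unfolding v_def using \<theta> \<eta> M N
    by (intro summable_on_product summable_on_cmult_right summable_on_geometric) auto
  have u: "u summable_on UNIV"
  proof -
    have "(\<lambda>(i, j). p i j * of_real \<rho> ^ i * of_real \<sigma> ^ j) summable_on UNIV"
      using has_sum_imp_summable[OF p[of "of_real \<rho>" "of_real \<sigma>"]] \<rho> \<sigma> by simp
    then have "(\<lambda>x. norm (case x of (i, j) \<Rightarrow> p i j * of_real \<rho> ^ i * of_real \<sigma> ^ j)) summable_on UNIV"
      by (simp only: summable_on_iff_abs_summable_on_complex)
    moreover have "(\<lambda>x. norm (case x of (i, j) \<Rightarrow> p i j * of_real \<rho> ^ i * of_real \<sigma> ^ j)) = u"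
      using \<rho> \<sigma> by (auto simp: u_def fun_eq_iff norm_mult norm_power)
    ultimately show ?thesis
      by simp
  qed
  have bound: "norm (H x y) \<le> u x * v y" for x y
  proof -
    obtain i j n m where xy: "x = (i, j)" "y = (n, m)"
      by fastforce
    have "norm (H x y) \<le> norm (p i j) * ((M * \<rho> ^ i * \<theta> ^ n) * (N * \<sigma> ^ j * \<eta> ^ m))"
      unfolding xy H_def prod.case norm_mult[of "p i j"] norm_mult[of "A i n * _"]
      using M \<rho> \<theta> by (intro mult_left_mono mult_mono bA bB) auto
    then show ?thesis
      by (simp add: xy u_def v_def mult_ac)
  qed
  have rows: "(H x has_sum h x) UNIV" for x
  proof -
    obtain i j where x: "x = (i, j)"
      by fastforce
    have "(H x has_sum h x) (Sigma UNIV (\<lambda>_. UNIV))"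
    proof (rule has_sum_SigmaI)
      show "((\<lambda>m. H x (n, m)) has_sum p i j * ((A i n * E n a) * b ^ j)) UNIV" for n
        unfolding x H_def prod.case by (intro has_sum_cmult_right sumB)
      show "((\<lambda>n. p i j * ((A i n * E n a) * b ^ j)) has_sum h x) UNIV"
        unfolding x h_def prod.case mult.assoc[of "p i j"]
        by (intro has_sum_cmult_right has_sum_cmult_left sumA)
      show "H x summable_on Sigma UNIV (\<lambda>_. UNIV)"
        using summable_on_complex_comparison[OF summable_on_cmult_right[OF v, of "u x"] bound] by simp
    qed
    then show ?thesis
      by simp
  qed
  have "((\<lambda>y. \<Sum>\<^sub>\<infinity>x. H x y) has_sum f a b) UNIV"
  proof (rule has_sum_exchange[OF u v _ _ bound rows])
    show "0 \<le> u x" "0 \<le> v y" for x y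
      using \<rho> \<sigma> \<theta> \<eta> M N by (auto simp: u_def v_def split: prod.split)
    show "(h has_sum f a b) UNIV"
      using p[OF a(2) b(2)] by (simp add: h_def)
  qed
  moreover have "(\<Sum>\<^sub>\<infinity>x. H x y) =
      (case y of (n, m) \<Rightarrow> (\<Sum>\<^sub>\<infinity>(i, j). p i j * A i n * B j m) * (E n a * F m b))" for y
  proof -
    obtain n m where y: "y = (n, m)"
      by fastforce
    have "(\<Sum>\<^sub>\<infinity>x. H x y) = (\<Sum>\<^sub>\<infinity>x. (case x of (i, j) \<Rightarrow> p i j * A i n * B j m) * (E n a * F m b))"
      by (intro infsum_cong) (auto simp: y H_def)
    then show ?thesis
      by (simp add: y infsum_cmult_left')
  qed
  ultimately show ?thesis
    by simp
qed

section \<open>Rational Newton interpolation\<close>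

text \<open>
The successive quotients \<open>g\<^sub>n\<close> of the interpolation process with nodes \<open>X\<close> and poles at the inverses of \<open>Y\<close>;
see \<open>newton_quotient_step\<close>.
\<close>

primrec newton_quotient ::
    "(nat \<Rightarrow> complex) \<Rightarrow> (nat \<Rightarrow> complex) \<Rightarrow> complex poly \<Rightarrow> nat \<Rightarrow> complex poly" where
  "newton_quotient X Y p 0 = p"
| "newton_quotient X Y p (Suc n) = synthetic_div ([:1, - Y n:] * newton_quotient X Y p n) (X n)"

definition newton_coeff ::
    "(nat \<Rightarrow> complex) \<Rightarrow> (nat \<Rightarrow> complex) \<Rightarrow> complex poly \<Rightarrow> nat \<Rightarrow> complex" where
  "newton_coeff X Y p n = poly ([:1, - Y n:] * newton_quotient X Y p n) (X n)"

lemma newton_quotient_step: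
  "(1 - a * Y n) * poly (newton_quotient X Y p n) a =
   newton_coeff X Y p n + (a - X n) * poly (newton_quotient X Y p (Suc n)) a"
proof -
  have "poly ([:1, - Y n:] * newton_quotient X Y p n) a =
        poly ([:- X n, 1:] * newton_quotient X Y p (Suc n) + [:newton_coeff X Y p n:]) a"
    unfolding newton_quotient.simps newton_coeff_def synthetic_div_correct' ..
  then show ?thesis
    by (simp add: algebra_simps del: newton_quotient.simps)
qed

text \<open>
The basis functions have one more factor in the denominator than in the numerator, while the remainder term has equally many:
the \<open>n\<close>-th step divides by \<open>1 - a Y\<^sub>n\<close> before the factor \<open>a - X\<^sub>n\<close> is split off.
\<close>

lemma newton_expansion_remainder:
  assumes "\<And>k. a * Y k \<noteq> 1"
  shows "poly p a =
    (\<Sum>k<n. newton_coeff X Y p k * ((\<Prod>l<k. a - X l) / (\<Prod>l\<le>k. 1 - a * Y l))) +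
    (\<Prod>l<n. a - X l) / (\<Prod>l<n. 1 - a * Y l) * poly (newton_quotient X Y p n) a"
proof (induction n)
  case (Suc n)
  have nz: "1 - a * Y n \<noteq> 0"
    using assms[of n] by auto
  let ?P = "\<Prod>l<n. a - X l" and ?Q = "\<Prod>l<n. 1 - a * Y l"
  have quot: "poly (newton_quotient X Y p n) a =
    (newton_coeff X Y p n + (a - X n) * poly (newton_quotient X Y p (Suc n)) a) / (1 - a * Y n)"
    using newton_quotient_step[of a Y n X p] nz by (metis nonzero_mult_div_cancel_left)
  have "?P / ?Q * ((c + x * g) / d) = c * (?P / (?Q * d)) + ?P * x / (?Q * d) * g" for c x g d
    by (simp add: add_divide_distrib distrib_left mult_ac)
  then have "?P / ?Q * poly (newton_quotient X Y p n) a =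
    newton_coeff X Y p n * (?P / (\<Prod>l\<le>n. 1 - a * Y l)) +
    (\<Prod>l<Suc n. a - X l) / (\<Prod>l<Suc n. 1 - a * Y l) * poly (newton_quotient X Y p (Suc n)) a"
    unfolding quot prod.lessThan_Suc lessThan_Suc_atMost[symmetric] .
  with Suc show ?case
    by (simp del: newton_quotient.simps)
qed simp

text \<open>
Both products are kept on their own side because \<open>\<rho> - |X\<^sub>k|\<close> is allowed to vanish here.
\<close>

lemma wnorm_newton_quotient:
  assumes "\<And>k. norm (X k) \<le> \<rho>"
  shows "wnorm \<rho> (newton_quotient X Y p n) * (\<Prod>k<n. \<rho> - norm (X k))
       \<le> wnorm \<rho> p * (\<Prod>k<n. 1 + \<rho> * norm (Y k))"
proof (induction n)
  case (Suc n)
  let ?g = "newton_quotient X Y p n"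
  have \<rho>: "\<rho> \<ge> 0"
    using assms[of 0] norm_ge_zero[of "X 0"] by linarith
  have "(\<rho> - norm (X n)) * wnorm \<rho> (newton_quotient X Y p (Suc n)) \<le> wnorm \<rho> ([:1, - Y n:] * ?g)"
    using wnorm_synthetic_div[OF assms[of n], of "[:1, - Y n:] * ?g"]
      norm_ge_zero[of "poly ([:1, - Y n:] * ?g) (X n)"]
    unfolding newton_quotient.simps by linarith
  also have "\<dots> \<le> (1 + \<rho> * norm (Y n)) * wnorm \<rho> ?g"
    by (rule wnorm_linear_factor[OF \<rho>])
  finally have step: "(\<rho> - norm (X n)) * wnorm \<rho> (newton_quotient X Y p (Suc n))
      \<le> (1 + \<rho> * norm (Y n)) * wnorm \<rho> ?g" .
  have "((\<rho> - norm (X n)) * wnorm \<rho> (newton_quotient X Y p (Suc n))) * (\<Prod>k<n. \<rho> - norm (X k))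
      \<le> ((1 + \<rho> * norm (Y n)) * wnorm \<rho> ?g) * (\<Prod>k<n. \<rho> - norm (X k))"
    using assms by (intro mult_right_mono[OF step] prod_nonneg) auto
  also have "\<dots> = (1 + \<rho> * norm (Y n)) * (wnorm \<rho> ?g * (\<Prod>k<n. \<rho> - norm (X k)))"
    by (simp add: mult_ac)
  also have "\<dots> \<le> (1 + \<rho> * norm (Y n)) * (wnorm \<rho> p * (\<Prod>k<n. 1 + \<rho> * norm (Y k)))"
    using \<rho> by (intro mult_left_mono[OF Suc]) auto
  finally show ?case
    by (simp add: mult_ac del: newton_quotient.simps)
qed simp

text \<open>
Since \<open>\<rho> - |X\<^sub>k| = \<rho> (1 - |X\<^sub>k|/\<rho>)\<close>, the factors other than \<open>\<rho>\<close> form convergent products, which go into \<open>K\<close>.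
\<close>

lemma newton_expansion_bounds:
  assumes X: "summable (\<lambda>k. norm (X k))" and Y: "summable (\<lambda>k. norm (Y k))"
    and "\<And>k. norm (X k) \<le> r" "r < \<rho>"
  shows "\<exists>K\<ge>0. \<forall>p n. wnorm \<rho> (newton_quotient X Y p n) * \<rho> ^ n \<le> K * wnorm \<rho> p \<and>
           norm (newton_coeff X Y p n) * \<rho> ^ n \<le> K * wnorm \<rho> p"
proof -
  have r: "0 \<le> r" and \<rho>: "\<rho> > 0"
    using assms(3)[of 0] assms(4) norm_ge_zero[of "X 0"] by linarith+
  have X': "norm (X k) < \<rho>" for k
    using assms(3)[of k] assms(4) by linarith
  have sY: "summable (\<lambda>k. norm (- (\<rho> * norm (Y k))))"
    using summable_mult[OF Y, of \<rho>] \<rho> by (simp add: abs_mult)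
  then obtain C where C: "\<And>n. norm (\<Prod>k<n. 1 - - (\<rho> * norm (Y k))) \<le> C"
    using bounded_partial_products[OF sY] by blast
  have sX: "summable (\<lambda>k. norm (norm (X k) / \<rho>))"
    using summable_divide[OF X, of \<rho>] \<rho> by simp
  have "norm (X k) / \<rho> \<noteq> 1" for k
    using X'[of k] \<rho> by auto
  then obtain C' where C': "C' > 0" "\<And>n. norm (inverse (\<Prod>k<n. 1 - norm (X k) / \<rho>)) \<le> C'"
    using bounded_inverse_partial_products[OF sX] by blast
  obtain y where y: "\<And>n. norm (Y n) \<le> y" 
    using summable_imp_Bseq[OF Y] unfolding Bseq_def by auto
  have y0: "y \<ge> 0"
    using y[of 0] norm_ge_zero[of "Y 0"] by linarith
  have C0: "C \<ge> 0"
    using C[of 0] by simp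
  have quot: "wnorm \<rho> (newton_quotient X Y p n) * \<rho> ^ n \<le> C * C' * wnorm \<rho> p" for p n
  proof -
    let ?P = "\<Prod>k<n. 1 - norm (X k) / \<rho>"
    have P: "?P > 0"
      using X' \<rho> by (intro prod_pos) auto
    have "(\<Prod>k<n. \<rho> - norm (X k)) = (\<Prod>k<n. \<rho> * (1 - norm (X k) / \<rho>))"
      using \<rho> by (intro prod.cong) (auto simp: field_simps)
    then have eq: "(\<Prod>k<n. \<rho> - norm (X k)) = \<rho> ^ n * ?P"
      by (simp add: prod.distrib)
    have "wnorm \<rho> (newton_quotient X Y p n) * \<rho> ^ n
        = (wnorm \<rho> (newton_quotient X Y p n) * (\<Prod>k<n. \<rho> - norm (X k))) * inverse ?P"
      unfolding eq using P by (simp only: mult.assoc right_inverse[OF less_imp_neq[symmetric]] mult_1_right)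
    also have "\<dots> \<le> (wnorm \<rho> p * (\<Prod>k<n. 1 + \<rho> * norm (Y k))) * C'"
    proof (rule mult_mono)
      show "wnorm \<rho> (newton_quotient X Y p n) * (\<Prod>k<n. \<rho> - norm (X k))
          \<le> wnorm \<rho> p * (\<Prod>k<n. 1 + \<rho> * norm (Y k))"
        by (intro wnorm_newton_quotient less_imp_le X')
      show "inverse ?P \<le> C'"
        using C'(2)[of n] by (simp only: real_norm_def)
      show "0 \<le> wnorm \<rho> p * (\<Prod>k<n. 1 + \<rho> * norm (Y k))"
        using \<rho> by (intro mult_nonneg_nonneg wnorm_nonneg prod_nonneg) auto
      show "0 \<le> inverse ?P"
        using P by simp
    qed
    also have "\<dots> \<le> (wnorm \<rho> p * C) * C'"
      using C[of n] C'(1) \<rho> by (intro mult_right_mono mult_left_mono wnorm_nonneg) auto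
    finally show ?thesis
      by (simp add: mult_ac)
  qed
  have coeff: "norm (newton_coeff X Y p n) * \<rho> ^ n \<le> (1 + \<rho> * y) * (C * C') * wnorm \<rho> p" for p n
  proof -
    have "norm (newton_coeff X Y p n) \<le> wnorm \<rho> ([:1, - Y n:] * newton_quotient X Y p n)"
      unfolding newton_coeff_def by (intro norm_poly_le_wnorm less_imp_le X')
    also have "\<dots> \<le> (1 + \<rho> * norm (Y n)) * wnorm \<rho> (newton_quotient X Y p n)"
      using \<rho> by (intro wnorm_linear_factor) auto
    also have "\<dots> \<le> (1 + \<rho> * y) * wnorm \<rho> (newton_quotient X Y p n)"
      using \<rho> y[of n] by (intro mult_right_mono wnorm_nonneg) auto
    finally have "norm (newton_coeff X Y p n) * \<rho> ^ n
        \<le> ((1 + \<rho> * y) * wnorm \<rho> (newton_quotient X Y p n)) * \<rho> ^ n"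
      using \<rho> by (intro mult_right_mono) auto
    also have "\<dots> \<le> (1 + \<rho> * y) * (C * C' * wnorm \<rho> p)"
      using mult_left_mono[OF quot[of p n], of "1 + \<rho> * y"] \<rho> y0 by (simp add: mult_ac)
    finally show ?thesis
      by (simp add: mult_ac)
  qed
  have "0 \<le> C * C' * wnorm \<rho> p" for p
    using C0 C'(1) \<rho> by (simp add: wnorm_nonneg)
  then have "C * C' * wnorm \<rho> p \<le> (1 + \<rho> * y) * (C * C') * wnorm \<rho> p" for p
    using mult_right_mono[of 1 "1 + \<rho> * y" "C * C' * wnorm \<rho> p"] \<rho> y0 by (simp add: mult_ac)
  then have "wnorm \<rho> (newton_quotient X Y p n) * \<rho> ^ n \<le> (1 + \<rho> * y) * (C * C') * wnorm \<rho> p" for p n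
    using quot[of p n] by (rule order_trans[rotated])
  moreover have "(1 + \<rho> * y) * (C * C') \<ge> 0"
    using C0 C'(1) \<rho> y0 by simp
  ultimately show ?thesis
    using coeff by blast
qed

lemma bounded_shifted_powers:
  assumes X: "summable (\<lambda>k. norm (X k :: complex))" and t: "norm a < t"
  shows "\<exists>C. \<forall>n. norm (\<Prod>k<n. a - X k) \<le> C * t ^ n"
proof -
  have t0: "t > 0"
    using t norm_ge_zero[of a] by linarith
  have sX: "summable (\<lambda>k. norm (- (norm (X k) / t)))"
    using summable_divide[OF X, of t] t0 by simp
  then obtain C where C: "\<And>n. norm (\<Prod>k<n. 1 - - (norm (X k) / t)) \<le> C"
    using bounded_partial_products[OF sX] by blast
  have "norm (\<Prod>k<n. a - X k) \<le> C * t ^ n" for n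
  proof -
    have "norm (\<Prod>k<n. a - X k) \<le> (\<Prod>k<n. t * (1 + norm (X k) / t))"
      unfolding prod_norm[symmetric]
    proof (rule prod_mono, intro conjI)
      fix k
      have "norm (a - X k) \<le> t + norm (X k)"
        using norm_triangle_ineq4[of a "X k"] t by linarith
      then show "norm (a - X k) \<le> t * (1 + norm (X k) / t)"
        using t0 by (simp add: distrib_left)
    qed simp
    also have "\<dots> = t ^ n * (\<Prod>k<n. 1 - - (norm (X k) / t))"
      by (simp add: prod.distrib)
    also have "\<dots> \<le> t ^ n * C"
      using C[of n] t0 by (intro mult_left_mono) auto
    finally show ?thesis
      by (simp add: mult.commute)
  qed
  then show ?thesis
    by blast
qed

lemma newton_basis_bound:
  assumes X: "summable (\<lambda>k. norm (X k))" and Y: "summable (\<lambda>k. norm (Y k))"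
    and a: "\<And>k. a * Y k \<noteq> (1 :: complex)" and t: "norm a < t"
  shows "\<exists>C. \<forall>n m. norm ((\<Prod>k<n. a - X k) / (\<Prod>k<m. 1 - a * Y k)) \<le> C * t ^ n"
proof -
  obtain C where C: "\<And>n. norm (\<Prod>k<n. a - X k) \<le> C * t ^ n"
    using bounded_shifted_powers[OF X t] by blast
  have sY: "summable (\<lambda>k. norm (a * Y k))"
    using summable_mult[OF Y, of "norm a"] by (simp add: norm_mult)
  then obtain C' where C': "C' > 0" "\<And>m. norm (inverse (\<Prod>k<m. 1 - a * Y k)) \<le> C'"
    using bounded_inverse_partial_products[OF sY a] by blast
  have "norm ((\<Prod>k<n. a - X k) / (\<Prod>k<m. 1 - a * Y k)) \<le> (C * C') * t ^ n" for n m
  proof -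
    have "norm ((\<Prod>k<n. a - X k) / (\<Prod>k<m. 1 - a * Y k)) \<le> (C * t ^ n) * C'"
      unfolding divide_inverse norm_mult using C[of n] C'(2)[of m]
      by (intro mult_mono order_trans[OF norm_ge_zero C[of n]]) auto
    then show ?thesis
      by (simp add: mult_ac)
  qed
  then show ?thesis
    by blast
qed

text \<open>
The remainder at \<open>a\<close> is bounded by a constant times \<open>(t/\<rho>)\<^sup>n\<close> for \<open>|a| < t < \<rho>\<close>: the product of nodes and poles
grows at most like \<open>t\<^sup>n\<close> and the quotient polynomial is \<open>O(\<rho>\<^sup>-\<^sup>n)\<close>.
\<close>

lemma newton_monomial_expansion:
  assumes X: "summable (\<lambda>k. norm (X k))" and Y: "summable (\<lambda>k. norm (Y k))"
    and r: "\<And>k. norm (X k) \<le> r" "r < R"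
  shows "monomial_expansion (\<lambda>i. newton_coeff X Y (monom 1 i))
           (\<lambda>n a. (\<Prod>k<n. a - X k) / (\<Prod>k\<le>n. 1 - a * Y k)) {a. \<forall>k. a * Y k \<noteq> 1} R"
  unfolding monomial_expansion_def
proof (intro conjI allI ballI impI)
  fix s assume s: "0 \<le> s" "s < R"
  define \<rho> where "\<rho> = (max s r + R) / 2"
  have \<rho>: "s < \<rho>" "r < \<rho>" "\<rho> < R"
    using s r(2) by (auto simp: \<rho>_def)
  obtain K where "\<And>p n. norm (newton_coeff X Y p n) * \<rho> ^ n \<le> K * wnorm \<rho> p"
    using newton_expansion_bounds[OF X Y r(1) \<rho>(2)] by blast
  then show "\<exists>\<rho>>s. \<rho> < R \<and> (\<exists>K. \<forall>i n. norm (newton_coeff X Y (monom 1 i) n) * \<rho> ^ n \<le> K * \<rho> ^ i)"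
    using \<rho> unfolding wnorm_monom[symmetric] by blast
next
  fix a :: complex and i
  assume "a \<in> {a. \<forall>k. a * Y k \<noteq> 1}" and aR: "norm a < R"
  then have a: "\<And>k. a * Y k \<noteq> 1"
    by auto
  define \<rho> where "\<rho> = (max (norm a) r + R) / 2"
  have \<rho>: "norm a < \<rho>" "r < \<rho>" "\<rho> < R"
    using aR r(2) by (auto simp: \<rho>_def)
  obtain t where t: "norm a < t" "t < \<rho>"
    using \<rho>(1) dense by blast
  have pos: "0 < t" "0 < \<rho>"
    using t norm_ge_zero[of a] by linarith+
  obtain K where K: "K \<ge> 0" "\<And>p n. wnorm \<rho> (newton_quotient X Y p n) * \<rho> ^ n \<le> K * wnorm \<rho> p"
    using newton_expansion_bounds[OF X Y r(1) \<rho>(2)] by blast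
  obtain C where C: "\<And>n m. norm ((\<Prod>k<n. a - X k) / (\<Prod>k<m. 1 - a * Y k)) \<le> C * t ^ n"
    using newton_basis_bound[OF X Y a t(1)] by blast
  let ?rem = "\<lambda>n. (\<Prod>l<n. a - X l) / (\<Prod>l<n. 1 - a * Y l) * poly (newton_quotient X Y (monom 1 i) n) a"
  have "norm (?rem n) \<le> (C * K * \<rho> ^ i) * (t / \<rho>) ^ n" for n
  proof -
    have "norm (poly (newton_quotient X Y (monom 1 i) n) a) \<le> wnorm \<rho> (newton_quotient X Y (monom 1 i) n)"
      using \<rho>(1) by (intro norm_poly_le_wnorm) auto
    also have "\<dots> \<le> K * \<rho> ^ i / \<rho> ^ n"
      using K(2)[of "monom 1 i" n] pos by (simp add: field_simps wnorm_monom)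
    finally have "norm (?rem n) \<le> (C * t ^ n) * (K * \<rho> ^ i / \<rho> ^ n)"
      unfolding norm_mult[of "_ / _"] using C[of n n]
      by (intro mult_mono order_trans[OF norm_ge_zero C[of n n]]) auto
    then show ?thesis
      by (simp add: power_divide mult_ac)
  qed
  moreover have "(\<lambda>n. (C * K * \<rho> ^ i) * (t / \<rho>) ^ n) \<longlonglongrightarrow> 0"
    using pos t(2) by (intro tendsto_mult_right_zero LIMSEQ_realpow_zero) auto
  ultimately have "?rem \<longlonglongrightarrow> 0"
    by (intro Lim_null_comparison[of ?rem]) auto
  then have "(\<lambda>n. a ^ i - ?rem n) \<longlonglongrightarrow> a ^ i - 0"
    by (intro tendsto_intros)
  moreover have "a ^ i - ?rem n = (\<Sum>k<n. newton_coeff X Y (monom 1 i) k *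
      ((\<Prod>l<k. a - X l) / (\<Prod>l\<le>k. 1 - a * Y l)))" for n
    using newton_expansion_remainder[where Y = Y and p = "monom 1 i" and n = n and X = X, OF a] by (simp add: poly_monom)
  ultimately show "(\<lambda>n. newton_coeff X Y (monom 1 i) n *
      ((\<Prod>k<n. a - X k) / (\<Prod>k\<le>n. 1 - a * Y k))) sums a ^ i"
    unfolding sums_def by simp
next
  fix a :: complex and t
  assume "a \<in> {a. \<forall>k. a * Y k \<noteq> 1}" "norm a < t"
  then show "\<exists>C. \<forall>n. norm ((\<Prod>k<n. a - X k) / (\<Prod>k\<le>n. 1 - a * Y k)) \<le> C * t ^ n"
    using newton_basis_bound[OF X Y, of a t] unfolding lessThan_Suc_atMost[symmetric] by blast
qed

section \<open>The one-variable basis of q-shifted factorials\<close>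

definition node_basis :: "complex \<Rightarrow> complex \<Rightarrow> nat \<Rightarrow> complex \<Rightarrow> complex" where
  "node_basis q \<alpha> n a = shifted_poly q \<alpha> a n / qpoch a q n"

definition node_weight :: "complex \<Rightarrow> complex \<Rightarrow> nat \<Rightarrow> complex" where
  "node_weight q \<alpha> n = (1 - \<alpha> * q ^ (2 * n)) / qpoch q q n"

lemma expansion_term_eq:
  "expansion_term q \<alpha> \<beta> a b n m =
     node_weight q \<alpha> n * node_weight q \<beta> m * (node_basis q \<alpha> n a * node_basis q \<beta> m b)"
  by (simp add: expansion_term_def node_basis_def node_weight_def mult_ac)

lemma shifted_poly_eq: "shifted_poly q \<alpha> a n = (\<Prod>k<n. a - \<alpha> * q ^ Suc k)"
  unfolding shifted_poly_def by (simp add: prod.atLeast1_atMost_eq)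

lemma norm_power_less_1:
  fixes q :: complex
  assumes "norm q < 1" "0 < n"
  shows "norm (q ^ n) < 1"
  using assms by (simp add: norm_power power_less_one_iff)

lemma qpoch_self_nonzero:
  assumes "norm q < 1"
  shows "qpoch q q n \<noteq> 0"
proof -
  have "1 - q * q ^ k \<noteq> 0" for k
    using norm_power_less_1[OF assms, of "Suc k"] by auto
  then show ?thesis
    by (simp add: qpoch_def)
qed

lemma summable_norm_geometric:
  fixes q c :: complex
  assumes "norm q < 1"
  shows "summable (\<lambda>k. norm (c * q ^ k))"
  unfolding norm_mult norm_power using assms by (intro summable_mult summable_geometric) simp

lemma node_basis_bound:
  assumes q: "norm q < 1" and a: "\<And>k. a * q ^ k \<noteq> 1" and t: "norm a < t"
  shows "\<exists>C. \<forall>n. norm (node_basis q \<alpha> n a) \<le> C * t ^ n"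
  using newton_basis_bound[where X = "\<lambda>k. \<alpha> * q ^ Suc k" and Y = "\<lambda>k. q ^ k", OF _ _ a t]
    summable_norm_geometric[OF q, of "\<alpha> * q"] summable_norm_geometric[OF q, of 1]
  unfolding node_basis_def qpoch_def shifted_poly_eq by (simp add: mult.assoc) blast

lemma prod_lessThan_add:
  fixes f :: "nat \<Rightarrow> 'a :: comm_monoid_mult"
  shows "(\<Prod>k<K + n. f k) = (\<Prod>k<K. f k) * (\<Prod>k<n. f (K + k))"
  by (induction n) (simp_all add: mult_ac)

text \<open>
The quotients \<open>\<phi>\<^sub>K\<^sub>+\<^sub>n/\<phi>\<^sub>K\<close> form the rational Newton basis with nodes \<open>\<alpha>q\<^sup>K\<^sup>+\<^sup>1, \<alpha>q\<^sup>K\<^sup>+\<^sup>2, \<dots>\<close>, all of modulus less than \<open>R\<close>, and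
the factor \<open>\<phi>\<^sub>K\<close> is put back by \<open>monomial_expansion_times_rational_factor\<close>, because its zeros are outside the disc. The case \<open>K = 0\<close>
is the full expansion, in which all nodes lie in the disc.
\<close>

lemma node_basis_monomial_expansion:
  assumes q: "norm q < 1" and R: "norm (\<alpha> * q ^ Suc K) < R"
    and far: "\<And>k. k < K \<Longrightarrow> R \<le> norm (\<alpha> * q ^ Suc k)"
  shows "\<exists>A. monomial_expansion A (node_basis q \<alpha>) {a. \<forall>k. a * q ^ k \<noteq> 1} R \<and>
           (\<forall>n<K. \<forall>i. A i n = 0)"
proof -
  define X where "X k = \<alpha> * q ^ Suc (K + k)" for k
  \<comment> \<open>The Newton basis has one more factor in its denominator than in its numerator; a pole at infinity compensates for this.\<close>
  define Y where "Y k = (case k of 0 \<Rightarrow> 0 | Suc j \<Rightarrow> q ^ (K + j))" for k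
  let ?D = "{a. \<forall>k. a * q ^ k \<noteq> 1}"
  have R0: "0 < R"
    using R norm_ge_zero[of "\<alpha> * q ^ Suc K"] by linarith
  have X: "summable (\<lambda>k. norm (X k))"
    using summable_norm_geometric[OF q, of "\<alpha> * q ^ Suc K"] by (simp add: X_def power_add mult_ac)
  have "summable (\<lambda>k. norm (Y (Suc k)))"
    using summable_norm_geometric[OF q, of "q ^ K"] by (simp add: Y_def power_add)
  then have Y: "summable (\<lambda>k. norm (Y k))"
    by (subst (asm) summable_Suc_iff)
  have Xle: "norm (X k) \<le> norm (\<alpha> * q ^ Suc K)" for k
  proof -
    have "norm (X k) = norm (\<alpha> * q ^ Suc K) * norm q ^ k"
      by (simp add: X_def power_add norm_mult norm_power)
    also have "\<dots> \<le> norm (\<alpha> * q ^ Suc K) * 1"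
      using q by (intro mult_left_mono power_le_one) auto
    finally show ?thesis
      by simp
  qed
  obtain A where A: "monomial_expansion A
      (\<lambda>n a. (\<Prod>k<K. a - \<alpha> * q ^ Suc k) / (\<Prod>k<K. 1 - a * q ^ k) *
             ((\<Prod>k<n. a - X k) / (\<Prod>k\<le>n. 1 - a * Y k)))
      {a \<in> {a. \<forall>k. a * Y k \<noteq> 1}. \<forall>k<K. a * q ^ k \<noteq> 1} R"
    using monomial_expansion_times_rational_factor[OF newton_monomial_expansion[OF X Y Xle R] R0,
        where x = "\<lambda>k. \<alpha> * q ^ Suc k" and y = "\<lambda>k. q ^ k", OF far] by blast
  have tail: "monomial_expansion A (\<lambda>n. node_basis q \<alpha> (K + n)) ?D R"
  proof (rule monomial_expansion_cong[OF A])
    show "?D \<subseteq> {a \<in> {a. \<forall>k. a * Y k \<noteq> 1}. \<forall>k<K. a * q ^ k \<noteq> 1}"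
      by (auto simp: Y_def split: nat.splits)
    show "(\<Prod>k<K. a - \<alpha> * q ^ Suc k) / (\<Prod>k<K. 1 - a * q ^ k) *
        ((\<Prod>k<n. a - X k) / (\<Prod>k\<le>n. 1 - a * Y k)) = node_basis q \<alpha> (K + n) a" for n a
    proof -
      have "(\<Prod>k\<le>n. 1 - a * Y k) = (\<Prod>k<n. 1 - a * q ^ (K + k))"
        by (subst lessThan_Suc_atMost[symmetric], subst prod.lessThan_Suc_shift) (simp add: Y_def)
      then show ?thesis
        by (simp add: node_basis_def qpoch_def shifted_poly_eq prod_lessThan_add X_def)
    qed
  qed
  define A' where "A' i n = (if n < K then 0 else A i (n - K))" for i n
  have "monomial_expansion A' (node_basis q \<alpha>) ?D R"
    unfolding monomial_expansion_def
  proof (intro conjI allI ballI impI)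
    fix s assume s: "0 \<le> s" "s < R"
    then obtain \<rho> C where \<rho>: "s < \<rho>" "\<rho> < R" and C: "\<And>i n. norm (A i n) * \<rho> ^ n \<le> C * \<rho> ^ i"
      using tail unfolding monomial_expansion_def by blast
    have "C \<ge> 0"
      using order_trans[OF norm_ge_zero] C[of 0 0] by force
    have "norm (A' i n) * \<rho> ^ n \<le> (C * \<rho> ^ K) * \<rho> ^ i" for i n
    proof (cases "n < K")
      case True
      then show ?thesis
        using \<open>C \<ge> 0\<close> s \<rho> by (simp add: A'_def)
    next
      case False
      then obtain j where n: "n = K + j"
        using le_Suc_ex not_less by blast
      show ?thesis
        using mult_left_mono[OF C[of i j], of "\<rho> ^ K"] s \<rho> by (simp add: A'_def n power_add mult_ac)
    qed
    with \<rho> show "\<exists>\<rho>>s. \<rho> < R \<and> (\<exists>C. \<forall>i n. norm (A' i n) * \<rho> ^ n \<le> C * \<rho> ^ i)"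
      by blast
  next
    fix a i assume "a \<in> ?D" "norm a < R"
    then have "(\<lambda>n. A i n * node_basis q \<alpha> (K + n) a) sums a ^ i"
      using tail unfolding monomial_expansion_def by blast
    then have "(\<lambda>n. A' i (n + K) * node_basis q \<alpha> (n + K) a) sums a ^ i"
      by (simp add: A'_def add.commute)
    then show "(\<lambda>n. A' i n * node_basis q \<alpha> n a) sums a ^ i"
      by (subst (asm) sums_iff_shift) (simp add: A'_def)
  next
    fix a t assume "a \<in> ?D" "norm a < t"
    then show "\<exists>C. \<forall>n. norm (node_basis q \<alpha> n a) \<le> C * t ^ n"
      by (intro node_basis_bound[OF q]) auto
  qed
  then show ?thesis
    by (intro exI[of _ A']) (simp add: A'_def)
qed

section \<open>Existence of the expansion\<close>

text \<open>
The term of index \<open>n\<close> vanishes identically when \<open>\<alpha>q\<^sup>2\<^sup>n = 1\<close>, so the expansions of the monomials must not use \<open>\<phi>\<^sub>n\<close>;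
all other normalising constants are divided out.
\<close>

lemma expands_on_bidisc_exists:
  assumes q: "norm q < 1" and f: "power_series_on_bidisc f R S"
    and A: "monomial_expansion A (node_basis q \<alpha>) {a. \<forall>k. a * q ^ k \<noteq> 1} R"
      "\<And>n i. \<alpha> * q ^ (2 * n) = 1 \<Longrightarrow> A i n = 0"
    and B: "monomial_expansion B (node_basis q \<beta>) {b. \<forall>k. b * q ^ k \<noteq> 1} S"
      "\<And>m j. \<beta> * q ^ (2 * m) = 1 \<Longrightarrow> B j m = 0"
  shows "\<exists>c. expands_on_bidisc q \<alpha> \<beta> f c R S"
proof -
  obtain p where p: "\<And>a b. norm a < R \<Longrightarrow> norm b < S \<Longrightarrow>
      ((\<lambda>(i, j). p i j * a ^ i * b ^ j) has_sum f a b) UNIV"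
    using f unfolding power_series_on_bidisc_def by blast
  define e where "e n m = (\<Sum>\<^sub>\<infinity>(i, j). p i j * A i n * B j m)" for n m
  define c where "c n m = e n m / (node_weight q \<alpha> n * node_weight q \<beta> m)" for n m
  have wA: "A i n = 0" if "node_weight q \<alpha> n = 0" for i n
    using that A(2) qpoch_self_nonzero[OF q] by (auto simp: node_weight_def)
  have wB: "B j m = 0" if "node_weight q \<beta> m = 0" for j m
    using that B(2) qpoch_self_nonzero[OF q] by (auto simp: node_weight_def)
  have term_eq: "c n m * expansion_term q \<alpha> \<beta> a b n m =
      e n m * (node_basis q \<alpha> n a * node_basis q \<beta> m b)" for a b n m
  proof (cases "node_weight q \<alpha> n = 0 \<or> node_weight q \<beta> m = 0")
    case True
    \<comment> \<open>Here \<open>c n m = 0\<close> by the convention on division by zero.\<close>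
    then have "e n m = 0"
      unfolding e_def using wA wB by (intro infsum_0) auto
    then show ?thesis
      by (simp add: c_def)
  next
    case False
    then show ?thesis
      by (simp add: c_def expansion_term_eq)
  qed
  have "((\<lambda>(n, m). c n m * expansion_term q \<alpha> \<beta> a b n m) has_sum f a b) UNIV"
    if "norm a < R" "norm b < S" "\<forall>k. a * q ^ k \<noteq> 1" "\<forall>k. b * q ^ k \<noteq> 1" for a b
    unfolding term_eq e_def using that by (intro bidisc_expansion[OF A(1) B(1) p]) auto
  then have "expands_on_bidisc q \<alpha> \<beta> f c R S"
    unfolding expands_on_bidisc_def using has_sum_pairs_imp_iterated by blast
  then show ?thesis
    by blast
qed

text \<open>
The radius is chosen as \<open>R = |\<alpha>q\<^sup>K|\<close> with \<open>K\<close> so large that \<open>R < 1\<close> and \<open>R \<le> R0\<close>. Then exactly the nodes after the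
\<open>K\<close>-th lie in the disc, and \<open>\<alpha>q\<^sup>2\<^sup>n = 1\<close> forces \<open>n < K\<close>, an index that the expansion does not use. If \<open>\<alpha>q = 0\<close>, all
nodes are \<open>0\<close> and nothing has to be dropped.
\<close>

lemma local_node_basis_expansion:
  assumes q: "norm q < 1" and "q = 0 \<longrightarrow> \<alpha> \<noteq> 1" and R0: "0 < R0"
  obtains R A where "0 < R" "R \<le> R0"
    "monomial_expansion A (node_basis q \<alpha>) {a. \<forall>k. a * q ^ k \<noteq> 1} R"
    "\<And>n i. \<alpha> * q ^ (2 * n) = 1 \<Longrightarrow> A i n = 0"
proof (cases "\<alpha> * q = 0")
  case True
  obtain A where A: "monomial_expansion A (node_basis q \<alpha>) {a. \<forall>k. a * q ^ k \<noteq> 1} R0"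
    using node_basis_monomial_expansion[OF q, of \<alpha> 0 R0] True R0 by auto
  have "\<alpha> * q ^ (2 * n) \<noteq> 1" for n
    using True assms(2) by (cases n) auto
  then show thesis
    using R0 A by (intro that[of R0 A]) auto
next
  case False
  then have nz: "\<alpha> \<noteq> 0" "q \<noteq> 0"
    by auto
  have "(\<lambda>k. norm \<alpha> * norm q ^ k) \<longlonglongrightarrow> 0"
    using q by (intro tendsto_mult_right_zero LIMSEQ_realpow_zero) auto
  then have "\<forall>\<^sub>F k in sequentially. norm \<alpha> * norm q ^ k < min R0 1"
    using R0 by (intro order_tendstoD) auto
  then obtain K where K: "norm \<alpha> * norm q ^ K < min R0 1"
    unfolding eventually_sequentially by blast
  define R where "R = norm \<alpha> * norm q ^ K"
  have R: "0 < R" "R \<le> R0" "R < 1"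
    using K nz by (auto simp: R_def)
  have near: "norm (\<alpha> * q ^ Suc K) < R"
    using nz q by (simp add: R_def norm_mult norm_power)
  have far: "R \<le> norm (\<alpha> * q ^ Suc k)" if "k < K" for k
    using that nz q unfolding R_def norm_mult norm_power
    by (intro mult_left_mono power_decreasing) auto
  obtain A where A: "monomial_expansion A (node_basis q \<alpha>) {a. \<forall>k. a * q ^ k \<noteq> 1} R"
    "\<And>n i. n < K \<Longrightarrow> A i n = 0"
    using node_basis_monomial_expansion[OF q near far] by blast
  have "n < K" if "\<alpha> * q ^ (2 * n) = 1" for n
  proof (rule ccontr)
    assume "\<not> n < K"
    then have "norm \<alpha> * norm q ^ (2 * n) \<le> norm \<alpha> * norm q ^ K"
      using q by (intro mult_left_mono power_decreasing) auto
    then have "norm (\<alpha> * q ^ (2 * n)) < 1"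
      using R(3) by (simp add: R_def norm_mult norm_power)
    with that show False
      by simp
  qed
  then show thesis
    using A R by (intro that[of R A]) auto
qed

lemma power_series_on_bidisc_mono:
  assumes "power_series_on_bidisc f R S" "R' \<le> R" "S' \<le> S"
  shows "power_series_on_bidisc f R' S'"
  using assms unfolding power_series_on_bidisc_def by (meson less_le_trans)

lemma local_expansion:
  assumes "norm q < 1" "analytic_at_origin f" "q = 0 \<longrightarrow> \<alpha> \<noteq> 1 \<and> \<beta> \<noteq> 1"
  shows "\<exists>c. \<exists>R>0. \<exists>S>0. expands_on_bidisc q \<alpha> \<beta> f c R S"
proof -
  obtain R0 S0 where f: "0 < R0" "0 < S0" "power_series_on_bidisc f R0 S0"
    using assms(2) unfolding analytic_at_origin_def by blast
  obtain R A where R: "0 < R" "R \<le> R0"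
    and A: "monomial_expansion A (node_basis q \<alpha>) {a. \<forall>k. a * q ^ k \<noteq> 1} R"
      "\<And>n i. \<alpha> * q ^ (2 * n) = 1 \<Longrightarrow> A i n = 0"
    using local_node_basis_expansion[of q \<alpha> R0] assms(1,3) f(1) by blast
  obtain S B where S: "0 < S" "S \<le> S0"
    and B: "monomial_expansion B (node_basis q \<beta>) {b. \<forall>k. b * q ^ k \<noteq> 1} S"
      "\<And>n i. \<beta> * q ^ (2 * n) = 1 \<Longrightarrow> B i n = 0"
    using local_node_basis_expansion[of q \<beta> S0] assms(1,3) f(2) by blast
  show ?thesis
    using expands_on_bidisc_exists[OF assms(1) power_series_on_bidisc_mono[OF f(3) R(2) S(2)] A B]
      R(1) S(1) by blast
qed

section \<open>Uniqueness of the coefficients\<close>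

lemma sums_zero_single_term:
  fixes f :: "nat \<Rightarrow> complex"
  assumes "f sums 0" "\<And>k. k \<noteq> n \<Longrightarrow> f k = 0"
  shows "f n = 0"
proof -
  have "f sums (\<Sum>k\<in>{n}. f k)"
    by (rule sums_finite) (use assms(2) in auto)
  with assms(1) show ?thesis
    using sums_unique2 by fastforce
qed

lemma qpoch_bounded:
  assumes q: "norm q < 1" and t: "norm t \<le> 1"
  shows "norm (qpoch t q n) \<le> 2 ^ n"
proof -
  have "norm (1 - t * q ^ k) \<le> 2" for k
  proof -
    have "norm (t * q ^ k) \<le> 1 * 1"
      unfolding norm_mult norm_power using q t by (intro mult_mono power_le_one) auto
    then show ?thesis
      using norm_triangle_ineq4[of 1 "t * q ^ k"] by simp
  qed
  then have "(\<Prod>k<n. norm (1 - t * q ^ k)) \<le> (\<Prod>k<n. 2)"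
    by (intro prod_mono) auto
  then show ?thesis
    by (simp add: qpoch_def prod_norm)
qed

text \<open>
The partial products for \<open>t\<close> are bounded below by those for the real numbers \<open>r\<close> and \<open>|q|\<close>, which gives a bound that is
uniform in \<open>t\<close>.
\<close>

lemma qpoch_inverse_bounded:
  assumes q: "norm q < 1" and r: "0 \<le> r" "r < 1"
  shows "\<exists>C. \<forall>n t. norm t \<le> r \<longrightarrow> norm (inverse (qpoch t q n)) \<le> C"
proof -
  have s: "summable (\<lambda>k. norm (r * norm q ^ k))"
    using q r by (simp add: summable_mult summable_geometric abs_mult)
  have less: "r * norm q ^ k < 1" for k
    using mult_left_mono[OF power_le_one[of "norm q" k] r(1)] q r by auto
  obtain C where C: "\<And>n. norm (inverse (\<Prod>k<n. 1 - r * norm q ^ k)) \<le> C"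
    using bounded_inverse_partial_products[OF s] less by (metis less_irrefl)
  have "norm (inverse (qpoch t q n)) \<le> C" if t: "norm t \<le> r" for t n
  proof -
    have "(\<Prod>k<n. 1 - r * norm q ^ k) \<le> (\<Prod>k<n. norm (1 - t * q ^ k))"
    proof (rule prod_mono, intro conjI)
      fix k
      show "0 \<le> 1 - r * norm q ^ k"
        using less[of k] by simp
      have "norm (t * q ^ k) \<le> r * norm q ^ k"
        unfolding norm_mult norm_power using t by (intro mult_right_mono) auto
      then show "1 - r * norm q ^ k \<le> norm (1 - t * q ^ k)"
        using norm_triangle_ineq2[of 1 "t * q ^ k"] by simp
    qed
    moreover have pos: "0 < (\<Prod>k<n. 1 - r * norm q ^ k)"
      using less by (intro prod_pos) simp
    ultimately have "inverse (\<Prod>k<n. norm (1 - t * q ^ k)) \<le> inverse (\<Prod>k<n. 1 - r * norm q ^ k)"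
      by (intro le_imp_inverse_le)
    also have "\<dots> \<le> C"
      using C[of n] pos by simp
    finally show ?thesis
      by (simp add: qpoch_def prod_norm norm_inverse)
  qed
  then show ?thesis
    by blast
qed

text \<open>
If all nodes are \<open>0\<close>, evaluation at the nodes yields only the first coefficient. Instead, the first nonvanishing term is
compared with the tail of the series at a small \<open>t > 0\<close>: convergence at one point \<open>r\<close> gives \<open>e\<^sub>l = O(r\<^sup>-\<^sup>l)\<close>, so the tail
is smaller than \<open>t\<^sup>n\<close> by a factor of order \<open>t\<close>.
\<close>

lemma confluent_node_basis_coeff_zero:
  assumes q: "norm q < 1" and \<alpha>: "\<alpha> * q = 0" and R: "0 < R"
    and zero: "\<And>a. norm a < R \<Longrightarrow> \<forall>k. a * q ^ k \<noteq> 1 \<Longrightarrow> (\<lambda>n. e n * node_basis q \<alpha> n a) sums 0"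
  shows "e n = 0"
proof (induction n rule: less_induct)
  case (less n)
  define r where "r = min R 1 / 2"
  have r: "0 < r" "r < R" "r < 1"
    using R by (auto simp: r_def)
  have "shifted_poly q \<alpha> a l = a ^ l" for a l
    using \<alpha> by (auto simp: shifted_poly_eq)
  then have basis: "node_basis q \<alpha> l a = a ^ l / qpoch a q l" for a l
    by (simp add: node_basis_def)
  have nonpole: "a * q ^ k \<noteq> 1" if "norm a \<le> r" for a k
  proof -
    have "norm (a * q ^ k) \<le> r * 1"
      unfolding norm_mult norm_power using that q r by (intro mult_mono power_le_one) auto
    then show ?thesis
      using r by auto
  qed
  have sums: "(\<lambda>l. e l * (a ^ l / qpoch a q l)) sums 0" if "norm a \<le> r" for a
    using zero[of a] nonpole[OF that] that r unfolding basis by auto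
  obtain C where C: "\<And>l t. norm t \<le> r \<Longrightarrow> norm (inverse (qpoch t q l)) \<le> C"
    using qpoch_inverse_bounded[OF q, of r] r by auto
  have C0: "0 \<le> C"
    using C[of 0 0] r by (simp add: qpoch_def)
  obtain C' where C': "\<And>l. norm (qpoch (of_real r) q l) \<le> C'"
    using bounded_partial_products[OF summable_norm_geometric[OF q, of "of_real r"]]
    unfolding qpoch_def by blast
  have "summable (\<lambda>l. e l * (of_real r ^ l / qpoch (of_real r) q l))"
    using sums[of "of_real r"] r by (simp add: sums_iff)
  then obtain B where B: "\<And>l. norm (e l * (of_real r ^ l / qpoch (of_real r) q l)) \<le> B"
    using summable_imp_Bseq unfolding Bseq_def by blast
  have B0: "0 \<le> B"
    using B[of 0] norm_ge_zero order_trans by blast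
  have e_bound: "norm (e l) * r ^ l \<le> B * C'" for l
  proof -
    have "qpoch (of_real r) q l \<noteq> 0"
      using nonpole[of "of_real r"] r by (auto simp: qpoch_def)
    then have "norm (e l) * r ^ l =
        norm (e l * (of_real r ^ l / qpoch (of_real r) q l)) * norm (qpoch (of_real r) q l)"
      using r by (simp add: norm_mult norm_divide norm_power)
    also have "\<dots> \<le> B * C'"
      using B0 by (intro mult_mono B C') auto
    finally show ?thesis .
  qed
  have C'0: "0 \<le> B * C'"
    using e_bound[of 0] order_trans[OF norm_ge_zero] by force
  define M where "M = B * C' * C"
  have bound: "norm (e n) \<le> 2 ^ n * M * (1 / r ^ n) * (t / (r - t))" if t: "0 < t" "t < r" for t
  proof -
    let ?f = "\<lambda>l. e l * (of_real t ^ l / qpoch (of_real t) q l)"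
    have f: "norm (?f l) \<le> M * (t / r) ^ l" for l
    proof -
      have "norm (e l) \<le> B * C' / r ^ l"
        using e_bound[of l] r by (simp add: field_simps)
      then have "norm (e l) * norm (inverse (qpoch (of_real t) q l)) \<le> (B * C' / r ^ l) * C"
        using t C'0 r by (intro mult_mono C) auto
      then have "norm (e l) * norm (inverse (qpoch (of_real t) q l)) * t ^ l \<le> (B * C' / r ^ l) * C * t ^ l"
        using t by (intro mult_right_mono) auto
      moreover have "norm (?f l) = norm (e l) * norm (inverse (qpoch (of_real t) q l)) * t ^ l"
        using t by (simp add: norm_mult norm_divide norm_inverse norm_power divide_inverse mult_ac)
      moreover have "(B * C' / r ^ l) * C * t ^ l = M * (t / r) ^ l"
        by (simp add: M_def power_divide)
      ultimately show ?thesis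
        by simp
    qed
    have "(\<lambda>l. ?f (l + Suc n)) sums (0 - (\<Sum>l<Suc n. ?f l))"
      using sums[of "of_real t"] t by (subst sums_iff_shift) simp
    moreover have "(\<Sum>l<Suc n. ?f l) = ?f n"
      using less.IH by simp
    ultimately have "(\<lambda>l. ?f (l + Suc n)) sums (- ?f n)"
      by simp
    moreover have "(\<lambda>l. M * (t / r) ^ Suc n * (t / r) ^ l) sums (M * (t / r) ^ Suc n * (1 / (1 - t / r)))"
      using t by (intro sums_mult geometric_sums) auto
    moreover have "norm (?f (l + Suc n)) \<le> M * (t / r) ^ Suc n * (t / r) ^ l" for l
      using f[of "l + Suc n"] by (simp add: power_add mult_ac)
    ultimately have "norm (- ?f n) \<le> M * (t / r) ^ Suc n * (1 / (1 - t / r))"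
      by (rule norm_sums_le)
    moreover have "M * (t / r) ^ Suc n * (1 / (1 - t / r)) = M * (1 / r ^ n) * (t / (r - t)) * t ^ n"
      using t by (simp add: field_simps)
    ultimately have le: "norm (?f n) \<le> M * (1 / r ^ n) * (t / (r - t)) * t ^ n"
      by simp
    have nz: "qpoch (of_real t) q n \<noteq> 0"
      using nonpole[of "of_real t"] t by (auto simp: qpoch_def)
    have "norm (e n) * t ^ n = norm (?f n) * norm (qpoch (of_real t) q n)"
      using t nz by (simp add: norm_mult norm_divide norm_power)
    also have "\<dots> \<le> (M * (1 / r ^ n) * (t / (r - t)) * t ^ n) * 2 ^ n"
      using t r by (intro mult_mono[OF le] qpoch_bounded[OF q] order_trans[OF norm_ge_zero le]) auto
    finally have "norm (e n) * t ^ n \<le> (2 ^ n * M * (1 / r ^ n) * (t / (r - t))) * t ^ n"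
      by (simp add: mult_ac)
    then show ?thesis
      by (rule mult_right_le_imp_le) (use t in simp)
  qed
  have "((\<lambda>t. 2 ^ n * M * (1 / r ^ n) * (t / (r - t))) \<longlongrightarrow> 2 ^ n * M * (1 / r ^ n) * (0 / (r - 0))) (at_right 0)"
    using r by (intro tendsto_intros) auto
  moreover have "\<forall>\<^sub>F t in at_right 0. norm (e n) \<le> 2 ^ n * M * (1 / r ^ n) * (t / (r - t))"
    using bound r(1) by (auto simp: eventually_at_right_field)
  ultimately have "norm (e n) \<le> 2 ^ n * M * (1 / r ^ n) * (0 / (r - 0))"
    by (rule tendsto_lowerbound) simp
  then show ?case
    by simp
qed

text \<open>
For \<open>\<alpha>q \<noteq> 0\<close> the nodes are distinct. At \<open>a = \<alpha>q\<^sup>n\<^sup>+\<^sup>1\<close> all basis functions after the \<open>n\<close>-th vanish, the \<open>n\<close>-th one does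
not, and the earlier coefficients are zero by induction. The assumption \<open>\<alpha>q\<^sup>n \<noteq> 1\<close> ensures that no node is a pole.
\<close>

lemma node_basis_coeff_zero:
  assumes q: "norm q < 1" and R: "norm (\<alpha> * q) < R" and \<alpha>: "\<And>n. \<alpha> * q ^ n \<noteq> 1"
    and zero: "\<And>a. norm a < R \<Longrightarrow> \<forall>k. a * q ^ k \<noteq> 1 \<Longrightarrow> (\<lambda>n. e n * node_basis q \<alpha> n a) sums 0"
  shows "e n = 0"
proof (cases "\<alpha> * q = 0")
  case True
  then show ?thesis
    using confluent_node_basis_coeff_zero[OF q True _ zero] R by auto
next
  case False
  then have nz: "\<alpha> \<noteq> 0" "q \<noteq> 0"
    by auto
  show ?thesis
  proof (induction n rule: less_induct)
    case (less n)
    define a where "a = \<alpha> * q ^ Suc n"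
    have "norm a = norm (\<alpha> * q) * norm q ^ n"
      by (simp add: a_def norm_mult norm_power)
    also have "\<dots> \<le> norm (\<alpha> * q) * 1"
      using q by (intro mult_left_mono power_le_one) auto
    finally have a: "norm a < R"
      using R by simp
    have pole: "a * q ^ k \<noteq> 1" for k
      using \<alpha>[of "Suc n + k"] by (simp add: a_def power_add mult_ac)
    have "shifted_poly q \<alpha> a k = 0" if "n < k" for k
      unfolding shifted_poly_eq by (rule prod_zero) (use that in \<open>auto simp: a_def\<close>)
    then have later: "node_basis q \<alpha> k a = 0" if "n < k" for k
      using that by (simp add: node_basis_def)
    have others: "e k * node_basis q \<alpha> k a = 0" if "k \<noteq> n" for k
      using that less.IH[of k] later[of k] by (cases "k < n") simp_all
    have "(\<lambda>k. e k * node_basis q \<alpha> k a) sums 0"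
      using pole by (intro zero a) simp
    then have "e n * node_basis q \<alpha> n a = 0"
      by (rule sums_zero_single_term) (rule others)
    moreover have "node_basis q \<alpha> n a \<noteq> 0"
    proof -
      have "a \<noteq> \<alpha> * q ^ Suc k" if "k < n" for k
      proof -
        have "norm q ^ n < norm q ^ k"
          using that q nz by (intro power_strict_decreasing) auto
        then have "q ^ n \<noteq> q ^ k"
          by (metis less_irrefl norm_power)
        then show ?thesis
          using nz by (simp add: a_def)
      qed
      moreover have "1 - a * q ^ k \<noteq> 0" for k
        using pole[of k] by simp
      ultimately show ?thesis
        by (simp add: node_basis_def shifted_poly_eq qpoch_def)
    qed
    ultimately show ?case
      by simp
  qed
qed

lemma node_basis_nonzero_point:
  assumes q: "norm q < 1" and R: "0 < R"
  obtains a where "norm a < R" "\<forall>k. a * q ^ k \<noteq> 1" "node_basis q \<alpha> n a \<noteq> 0"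
proof -
  let ?Z = "(\<lambda>k. \<alpha> * q ^ Suc k) ` {..<n}"
  have "\<not> ball 0 (min R 1) \<subseteq> ?Z"
    using R finite_imp_not_open[of "ball (0::complex) (min R 1)"] finite_subset[of _ ?Z] by auto
  then obtain a where "a \<in> ball 0 (min R 1)" and notin: "a \<notin> ?Z"
    by blast
  then have a: "norm a < R" "norm a < 1"
    by auto
  have pole: "a * q ^ k \<noteq> 1" for k
  proof -
    have "norm (a * q ^ k) \<le> norm a * 1"
      unfolding norm_mult norm_power using q by (intro mult_left_mono power_le_one) auto
    then show ?thesis
      using a by auto
  qed
  then have "1 - a * q ^ k \<noteq> 0" for k
    by (metis right_minus_eq)
  with notin have "node_basis q \<alpha> n a \<noteq> 0"
    by (auto simp: node_basis_def shifted_poly_eq qpoch_def)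
  with a pole show thesis
    using that by blast
qed

text \<open>
For fixed \<open>b\<close> the inner sums are the coefficients of an expansion of \<open>0\<close> in the variable \<open>a\<close>, so they vanish; then each
inner sum is an expansion of \<open>0\<close> in the variable \<open>b\<close>.
\<close>

lemma expands_on_bidisc_unique:
  assumes q: "norm q < 1"
    and R: "norm (\<alpha> * q) < R" "\<And>n. \<alpha> * q ^ n \<noteq> 1"
    and S: "norm (\<beta> * q) < S" "\<And>n. \<beta> * q ^ n \<noteq> 1"
    and c: "expands_on_bidisc q \<alpha> \<beta> f c R S" and c': "expands_on_bidisc q \<alpha> \<beta> f c' R S"
  shows "c = c'"
proof -
  define d where "d n m = (c n m - c' n m) * node_weight q \<alpha> n * node_weight q \<beta> m" for n m
  have R0: "0 < R"
    using R(1) norm_ge_zero[of "\<alpha> * q"] by linarith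
  have weight: "node_weight q \<gamma> n \<noteq> 0" if "\<And>n. \<gamma> * q ^ n \<noteq> 1" for \<gamma> n
    using that[of "2 * n"] qpoch_self_nonzero[OF q] by (simp add: node_weight_def)
  have diff: "summable (\<lambda>m. node_basis q \<alpha> n a * (d n m * node_basis q \<beta> m b))"
    "(\<lambda>n. \<Sum>m. node_basis q \<alpha> n a * (d n m * node_basis q \<beta> m b)) sums 0"
    if ab: "norm a < R" "norm b < S" "\<forall>k. a * q ^ k \<noteq> 1" "\<forall>k. b * q ^ k \<noteq> 1" for a b n
  proof -
    let ?t = "expansion_term q \<alpha> \<beta> a b"
    have eq: "node_basis q \<alpha> n a * (d n m * node_basis q \<beta> m b) = c n m * ?t n m - c' n m * ?t n m" for n m
      by (simp add: d_def expansion_term_eq algebra_simps)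
    have s: "summable (\<lambda>m. c n m * ?t n m)" "summable (\<lambda>m. c' n m * ?t n m)"
      "(\<lambda>n. \<Sum>m. c n m * ?t n m) sums f a b" "(\<lambda>n. \<Sum>m. c' n m * ?t n m) sums f a b" for n
      using c c' ab unfolding expands_on_bidisc_def by blast+
    show "summable (\<lambda>m. node_basis q \<alpha> n a * (d n m * node_basis q \<beta> m b))"
      unfolding eq by (intro summable_diff s)
    have "(\<Sum>m. node_basis q \<alpha> n a * (d n m * node_basis q \<beta> m b)) =
        (\<Sum>m. c n m * ?t n m) - (\<Sum>m. c' n m * ?t n m)" for n
      unfolding eq by (rule suminf_diff[symmetric]) (rule s)+
    then show "(\<lambda>n. \<Sum>m. node_basis q \<alpha> n a * (d n m * node_basis q \<beta> m b)) sums 0"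
      using sums_diff[OF s(3,4)] by simp
  qed
  have d0: "d n m = 0" for n m
  proof (rule node_basis_coeff_zero[OF q S, where e = "d n"])
    fix b assume b: "norm b < S" "\<forall>k. b * q ^ k \<noteq> 1"
    \<comment> \<open>Summability is known only after multiplication by \<open>\<phi>\<^sub>n(a)\<close>; it is transferred at a point \<open>a\<close> where \<open>\<phi>\<^sub>n(a)\<close> is nonzero.\<close>
    have summable: "summable (\<lambda>m. d n m * node_basis q \<beta> m b)" for n
    proof -
      obtain a where a: "norm a < R" "\<forall>k. a * q ^ k \<noteq> 1" "node_basis q \<alpha> n a \<noteq> 0"
        using node_basis_nonzero_point[OF q R0] by blast
      show ?thesis
        using diff(1)[OF a(1) b(1) a(2) b(2), of n] a(3) by (simp add: summable_cmult_iff)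
    qed
    have "(\<Sum>m. d n m * node_basis q \<beta> m b) = 0"
    proof (rule node_basis_coeff_zero[OF q R, where e = "\<lambda>n. \<Sum>m. d n m * node_basis q \<beta> m b"])
      fix a assume a: "norm a < R" "\<forall>k. a * q ^ k \<noteq> 1"
      show "(\<lambda>n. (\<Sum>m. d n m * node_basis q \<beta> m b) * node_basis q \<alpha> n a) sums 0"
        using diff(2)[OF a(1) b(1) a(2) b(2)] by (simp add: suminf_mult[OF summable] mult.commute)
    qed
    with summable show "(\<lambda>m. d n m * node_basis q \<beta> m b) sums 0"
      by (simp add: sums_iff)
  qed
  have "c n m = c' n m" for n m
    using d0[of n m] weight[OF R(2), of n] weight[OF S(2), of m] by (simp add: d_def)
  then show ?thesis
    by (intro ext)
qed

theorem theorem1p5: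
  fixes q \<alpha> \<beta> :: complex and f :: "complex \<Rightarrow> complex \<Rightarrow> complex"
  assumes "norm q < 1"
    and "analytic_at_origin f"
  shows "((q = 0 \<longrightarrow> \<alpha> \<noteq> 1 \<and> \<beta> \<noteq> 1) \<longrightarrow>
            (\<exists>c. \<exists>R>0. \<exists>S>0. expands_on_bidisc q \<alpha> \<beta> f c R S))
       \<and> (\<forall>R S. power_series_on_bidisc f R S \<longrightarrow>
            norm (\<alpha> * q) < R \<longrightarrow> norm (\<beta> * q) < S \<longrightarrow>
            (\<forall>n. \<alpha> * q ^ n \<noteq> 1) \<longrightarrow> (\<forall>n. \<beta> * q ^ n \<noteq> 1) \<longrightarrow>
            (\<exists>!c. expands_on_bidisc q \<alpha> \<beta> f c R S))"
proof (intro conjI impI allI)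
  assume "q = 0 \<longrightarrow> \<alpha> \<noteq> 1 \<and> \<beta> \<noteq> 1"
  then show "\<exists>c. \<exists>R>0. \<exists>S>0. expands_on_bidisc q \<alpha> \<beta> f c R S"
    by (rule local_expansion[OF assms])
next
  fix R S
  assume f: "power_series_on_bidisc f R S"
    and R: "norm (\<alpha> * q) < R" and S: "norm (\<beta> * q) < S"
    and \<alpha>: "\<forall>n. \<alpha> * q ^ n \<noteq> 1" and \<beta>: "\<forall>n. \<beta> * q ^ n \<noteq> 1"
  obtain A where A: "monomial_expansion A (node_basis q \<alpha>) {a. \<forall>k. a * q ^ k \<noteq> 1} R"
    using node_basis_monomial_expansion[OF assms(1), of \<alpha> 0 R] R by auto
  obtain B where B: "monomial_expansion B (node_basis q \<beta>) {b. \<forall>k. b * q ^ k \<noteq> 1} S"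
    using node_basis_monomial_expansion[OF assms(1), of \<beta> 0 S] S by auto
  show "\<exists>!c. expands_on_bidisc q \<alpha> \<beta> f c R S"
  proof (rule ex_ex1I)
    show "\<exists>c. expands_on_bidisc q \<alpha> \<beta> f c R S"
      using \<alpha> \<beta> by (intro expands_on_bidisc_exists[OF assms(1) f A _ B]) auto
    show "c = c'" if "expands_on_bidisc q \<alpha> \<beta> f c R S" "expands_on_bidisc q \<alpha> \<beta> f c' R S" for c c'
      using \<alpha> \<beta> that by (intro expands_on_bidisc_unique[OF assms(1) R _ S _]) auto
  qed
qed

end
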